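(* Let $p$ be an odd prime. Then $$\sum_{n=1}^{p-1}\frac{V_n}{16^n}\equiv\frac72p^3B_{p-3}\pmod{p^4}.$$
   Context: For $n\ge0$, $V_n=\sum_{k=0}^n\binom{2k}{k}^2\binom{2n-2k}{n-k}^2$. The Bernoulli numbers $B_n$ are given by $B_0=1$ and $\sum_{k=0}^{n-1}\binom{n}{k}B_k=0$ for $n\ge2$. Congruences between rationals with denominators prime to $p$ are taken in the ring of such rationals. *)

theory Defs
  imports Complex_Main "HOL-Computational_Algebra.Primes"
begin

definition V :: "nat \<Rightarrow> nat" where
  "V n = (\<Sum>k=0..n. ((2 * k) choose k)\<^sup>2 * ((2 * n - 2 * k) choose (n - k))\<^sup>2)"

text \<open>
  The recursion is the defining relation of the Bernoulli numbers for the index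
  \<open>n + 1\<close>, solved for its last term \<open>(n + 1) * bernoulli n\<close>; see the lemma
  \<open>sum_binomial_bernoulli\<close>.
\<close>

fun bernoulli :: "nat \<Rightarrow> rat" where
  "bernoulli n =
     (if n = 0 then 1
      else - (\<Sum>k<n. of_nat (Suc n choose k) * bernoulli k) / of_nat (Suc n))"

declare bernoulli.simps [simp del]

lemma bernoulli_0 [simp]: "bernoulli 0 = 1"
  by (simp add: bernoulli.simps)

lemma sum_binomial_bernoulli:
  assumes "n \<ge> 2"
  shows "(\<Sum>k=0..n - 1. of_nat (n choose k) * bernoulli k) = 0"
proof -
  obtain m where n: "n = Suc m" and m: "m \<noteq> 0"
    using assms by (cases n) auto
  have "of_nat (Suc m) * bernoulli m = - (\<Sum>k<m. of_nat (Suc m choose k) * bernoulli k)"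
    using m by (subst bernoulli.simps) (simp del: of_nat_Suc)
  moreover have "{0..n - 1} = insert m {..<m}"
    using n by auto
  ultimately show ?thesis
    using n by simp
qed

text \<open>The ring of rationals whose denominator in lowest terms is prime to \<open>p\<close>.\<close>

definition p_integral :: "nat \<Rightarrow> rat set" where
  "p_integral p = {x. coprime (snd (quotient_of x)) (int p)}"

text \<open>Congruence modulo \<open>m\<close> in that ring: the quotient of the difference by \<open>m\<close> is taken
  in the ring, not in the field of all rationals.\<close>

definition p_cong :: "nat \<Rightarrow> nat \<Rightarrow> rat \<Rightarrow> rat \<Rightarrow> bool" where
  "p_cong p m x y \<longleftrightarrow>
     x \<in> p_integral p \<and> y \<in> p_integral p \<and> (\<exists>z\<in>p_integral p. x - y = of_nat m * z)"

end

theory Submission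
  imports Defs "HOL-Number_Theory.Residues" "HOL-Computational_Algebra.Formal_Power_Series"
begin

text \<open>
  By Clausen's formula, the square of \<open>\<Sum>\<^sub>k C(2k,k)\<^sup>2 (x/16)\<^sup>k\<close> is
  \<open>\<Sum>\<^sub>k C(2k,k)\<^sup>3 (x(1 - x)/16)\<^sup>k\<close>. Hence the sum of \<open>V n / 16^n\<close> over \<open>1 \<le> n < p\<close> is a sum
  over \<open>k\<close> in which, with \<open>h = (p - 1)/2\<close>, only \<open>h < k < p\<close> contributes, and it reduces modulo
  \<open>p^4\<close> to \<open>p\<close> times \<open>\<Sum>\<^sub>k C(2k,k)\<^sup>2/(16^k k)\<close> over \<open>h < k < p\<close>. There \<open>C(2k,k)\<^sup>2/16^k\<close> is congruent
  modulo \<open>p\<^sup>3\<close> to \<open>(p/4) (-1)^h (k - 1 - h)! (k + h)!/k!\<^sup>2\<close>, and summed over \<open>k\<close> with weights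
  \<open>1/k\<close> these terms have an exact evaluation by harmonic numbers and the ratios
  \<open>(M + m)! (M - m)!/M!\<^sup>2\<close>. What remains are congruences between harmonic sums, which express
  everything by \<open>\<Sum> 1/(i j\<^sup>2)\<close> over \<open>0 < i < j < p\<close>; Faulhaber's formula and Fermat's theorem
  identify this double sum with \<open>B\<^sub>p\<^sub>-\<^sub>3\<close> modulo \<open>p\<close>.
\<close>

section \<open>Clausen's formula\<close>

unbundle fps_syntax

text \<open>The hypergeometric series 2F1(1/2, 1/2; 1; x).\<close>

definition sq_series :: "rat fps" where
  "sq_series = Abs_fps (\<lambda>k. of_nat ((2 * k) choose k) ^ 2 / 16 ^ k)"

text \<open>The hypergeometric series 3F2(1/2, 1/2, 1/2; 1, 1; 4x). Base 16 instead of 64 absorbs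
  the 4, so that \<open>quad\<close> itself is substituted in Clausen's formula.\<close>

definition cube_series :: "rat fps" where
  "cube_series = Abs_fps (\<lambda>k. of_nat ((2 * k) choose k) ^ 3 / 16 ^ k)"

lemma sq_series_nth: "sq_series $ k = of_nat ((2 * k) choose k) ^ 2 / 16 ^ k"
  by (simp add: sq_series_def)

lemma central_binomial_Suc:
  "of_nat (Suc k) * of_nat ((2 * Suc k) choose Suc k)
    = (2 * (2 * of_nat k + 1) * of_nat ((2 * k) choose k) :: rat)"
proof -
  have 1: "Suc k * ((2 * Suc k) choose Suc k) = (2 * Suc k) * (Suc (2 * k) choose k)"
    using Suc_times_binomial[of k "Suc (2 * k)"] by simp
  have 2: "Suc k * (Suc (2 * k) choose k) = Suc (2 * k) * ((2 * k) choose k)"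
    using binomial_absorb_comp[of "Suc (2 * k)" k] by simp
  have "Suc k * (Suc k * ((2 * Suc k) choose Suc k)) = Suc k * (2 * (2 * k + 1) * ((2 * k) choose k))"
  proof -
    have "Suc k * (2 * Suc k * (Suc (2 * k) choose k)) = 2 * Suc k * (Suc k * (Suc (2 * k) choose k))"
      by (simp only: ac_simps)
    also have "\<dots> = Suc k * (2 * (2 * k + 1) * ((2 * k) choose k))"
      unfolding 2 by (simp only: ac_simps Suc_eq_plus1)
    finally show ?thesis unfolding 1 .
  qed
  hence "Suc k * ((2 * Suc k) choose Suc k) = 2 * (2 * k + 1) * ((2 * k) choose k)"
    by (simp only: mult_cancel1) simp
  hence "(of_nat (Suc k * ((2 * Suc k) choose Suc k)) :: rat) = of_nat (2 * (2 * k + 1) * ((2 * k) choose k))"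
    by (rule arg_cong)
  thus ?thesis by (simp only: of_nat_mult of_nat_add of_nat_numeral of_nat_1)
qed

lemma sq_series_Suc:
  "of_nat (Suc k) ^ 2 * sq_series $ Suc k = (2 * of_nat k + 1) ^ 2 / 4 * sq_series $ k"
proof -
  have "of_nat (Suc k) ^ 2 * sq_series $ Suc k
      = (of_nat (Suc k) * of_nat ((2 * Suc k) choose Suc k)) ^ 2 / 16 ^ Suc k"
    by (simp add: sq_series_def power_mult_distrib del: of_nat_Suc)
  thus ?thesis
    unfolding central_binomial_Suc power_mult_distrib by (simp add: sq_series_def)
qed

lemma cube_series_Suc:
  "of_nat (Suc k) ^ 3 * cube_series $ Suc k = (2 * of_nat k + 1) ^ 3 / 2 * cube_series $ k"
proof -
  have "of_nat (Suc k) ^ 3 * cube_series $ Suc k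
      = (of_nat (Suc k) * of_nat ((2 * Suc k) choose Suc k)) ^ 3 / 16 ^ Suc k"
    by (simp add: cube_series_def power_mult_distrib del: of_nat_Suc)
  thus ?thesis
    unfolding central_binomial_Suc power_mult_distrib by (simp add: cube_series_def)
qed

abbreviation quad :: "rat fps" where "quad \<equiv> fps_X * (1 - fps_X)"

lemma deriv_quad: "fps_deriv quad = 1 - 2 * fps_X"
  by (simp add: algebra_simps)

lemma X_deriv_nth [simp]: "(fps_X * fps_deriv f) $ n = (of_nat n * f $ n :: rat)"
  by (cases n) simp_all

text \<open>The hypergeometric equation in self-adjoint form. Its coefficient at n is the recurrence
  \<open>sq_series_Suc\<close>, because n^2 + n + 1/4 = (2n + 1)^2/4.\<close>

lemma sq_series_ode: "fps_deriv (quad * fps_deriv sq_series) = fps_const (1 / 4) * sq_series"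
proof (rule fps_ext)
  fix n
  define T where "T = fps_X * fps_deriv sq_series"
  have quad: "quad * fps_deriv sq_series = T - fps_X * T"
    by (simp add: T_def algebra_simps)
  have T: "T $ m = of_nat m * sq_series $ m" for m
    by (simp add: T_def)
  show "fps_deriv (quad * fps_deriv sq_series) $ n = (fps_const (1 / 4) * sq_series) $ n"
    unfolding quad fps_deriv_nth using sq_series_Suc[of n]
    by (simp add: T del: of_nat_Suc) (simp add: field_simps power2_eq_square)
qed

text \<open>Both sides of Clausen's formula solve the third-order equation below, the symmetric square
  of the second-order equation for \<open>sq_series\<close>; in terms of \<open>quad\<close> no division is needed.\<close>

lemma square_ode:
  fixes y :: "rat fps"
  assumes y: "fps_deriv (quad * fps_deriv y) = fps_const (1 / 4) * y"
  shows "fps_deriv (quad * fps_deriv (quad * fps_deriv (y * y)))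
           = quad * fps_deriv (y * y) + fps_const (1 / 2) * fps_deriv quad * (y * y)"
proof -
  \<comment> \<open>The equation becomes the first-order system quad y' = a, a' = q y, in which the
    products y y, y a and a a can be differentiated without second derivatives.\<close>
  define a where "a = quad * fps_deriv y"
  define q :: "rat fps" where "q = fps_const (1 / 4)"
  have Da: "fps_deriv a = q * y" using y by (simp add: a_def q_def)
  have q4: "4 * q = 1"
    unfolding q_def by (simp add: numeral_fps_const)
  have q2: "fps_const (1 / 2) = 2 * q"
    unfolding q_def by (simp add: numeral_fps_const)
  have 1: "quad * fps_deriv (y * y) = 2 * (y * a)"
    by (simp add: a_def algebra_simps)
  have "fps_deriv (quad * fps_deriv (y * y)) = 2 * (fps_deriv y * a + y * (q * y))"
    unfolding 1 by (simp add: Da algebra_simps)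
  hence "quad * fps_deriv (quad * fps_deriv (y * y)) = quad * (2 * (fps_deriv y * a + y * (q * y)))"
    by (simp only:)
  also have "\<dots> = 2 * (a * a) + 2 * q * (quad * (y * y))"
    by (simp add: a_def algebra_simps)
  finally have "fps_deriv (quad * fps_deriv (quad * fps_deriv (y * y)))
      = fps_deriv (2 * (a * a) + 2 * q * (quad * (y * y)))" by (rule arg_cong)
  also have "\<dots> = 2 * (a * (q * y) + q * y * a) + 2 * q * (fps_deriv quad * (y * y) + quad * fps_deriv (y * y))"
    by (simp only: fps_deriv_add fps_deriv_mult Da) (simp add: q_def algebra_simps)
  also have "\<dots> = 4 * q * (2 * (y * a)) + 2 * q * fps_deriv quad * (y * y)"
    unfolding 1 by (simp add: algebra_simps)
  finally show ?thesis unfolding q4 q2 1 by simp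
qed

text \<open>Coefficientwise this is \<open>cube_series_Suc\<close>. The factor
  \<open>1 - 4 * fps_X\<close> is kept apart because the substitution of \<open>quad\<close> turns
  it into the square of \<open>fps_deriv quad\<close>.\<close>

lemma cube_series_ode:
  "fps_deriv ((1 - 4 * fps_X) * (fps_X * fps_deriv (fps_X * fps_deriv cube_series))
      - 2 * fps_X * (fps_X * fps_deriv cube_series))
    = fps_X * fps_deriv cube_series + fps_const (1 / 2) * cube_series" (is "fps_deriv ?L = ?R")
proof (rule fps_ext)
  fix n
  define T where "T = fps_X * fps_deriv cube_series"
  define U where "U = fps_X * fps_deriv T"
  have L: "?L = U - fps_const 4 * (fps_X * U) - fps_const 2 * (fps_X * T)"
    by (simp add: T_def U_def algebra_simps numeral_fps_const)
  have T: "T $ m = of_nat m * cube_series $ m" for m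
    by (simp add: T_def)
  have U: "U $ m = of_nat m * T $ m" for m
    by (simp add: U_def)
  show "fps_deriv ?L $ n = ?R $ n"
    unfolding L unfolding fps_deriv_nth T_def[symmetric] using cube_series_Suc[of n]
    by (simp add: T U del: of_nat_Suc) (simp add: field_simps power3_eq_cube)
qed

text \<open>A change of variable: by the chain rule, \<open>quad\<close> times the derivative of
  f(quad) is (x f')(quad) times the derivative of \<open>quad\<close>.\<close>

lemma compose_quad_ode:
  fixes C :: "rat fps"
  assumes C: "fps_deriv ((1 - 4 * fps_X) * (fps_X * fps_deriv (fps_X * fps_deriv C))
      - 2 * fps_X * (fps_X * fps_deriv C)) = fps_X * fps_deriv C + fps_const (1 / 2) * C"
  shows "fps_deriv (quad * fps_deriv (quad * fps_deriv (C oo quad)))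
           = quad * fps_deriv (C oo quad) + fps_const (1 / 2) * fps_deriv quad * (C oo quad)"
proof -
  define T where "T = fps_X * fps_deriv C"
  have P0: "quad $ 0 = 0" by simp
  have XP: "fps_X oo quad = quad" by (rule fps_X_fps_compose_startby0) simp
  note comp = fps_compose_mult_distrib[OF P0] fps_compose_deriv[OF P0]
    fps_compose_add_distrib fps_compose_sub_distrib
  have c1: "(fps_X * fps_deriv f) oo quad = quad * (fps_deriv f oo quad)" for f :: "rat fps"
    by (simp only: comp XP)
  have 1: "quad * fps_deriv (C oo quad) = (T oo quad) * fps_deriv quad"
    by (simp only: comp XP T_def) (simp only: ac_simps)
  \<comment> \<open>The square of the derivative of \<open>quad\<close> supplies the coefficient 1 -
    4x of the assumed equation, and the second derivative -2 supplies the coefficient -2x.\<close>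
  have sq: "fps_deriv quad * fps_deriv quad = 1 - 4 * quad" unfolding deriv_quad by (simp add: algebra_simps)
  have dd: "fps_deriv (fps_deriv quad) = - 2" unfolding deriv_quad by simp
  have n4: "(1 - 4 * fps_X) oo quad = 1 - 4 * quad" and n2: "(2 * fps_X) oo quad = 2 * quad"
    by (simp_all only: comp XP numeral_fps_const fps_const_compose fps_compose_1)
  have "quad * fps_deriv (quad * fps_deriv (C oo quad))
      = (quad * (fps_deriv T oo quad)) * (fps_deriv quad * fps_deriv quad) + quad * (T oo quad) * fps_deriv (fps_deriv quad)"
    unfolding 1 by (simp only: fps_deriv_mult[of "T oo quad"] comp(2)) (simp only: algebra_simps)
  also have "\<dots> = ((1 - 4 * fps_X) * (fps_X * fps_deriv T) - 2 * fps_X * T) oo quad"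
    unfolding sq dd by (simp only: comp XP n4 n2) (simp add: algebra_simps)
  finally have "fps_deriv (quad * fps_deriv (quad * fps_deriv (C oo quad)))
      = (fps_deriv ((1 - 4 * fps_X) * (fps_X * fps_deriv T) - 2 * fps_X * T) oo quad) * fps_deriv quad"
    by (simp only: comp(2))
  also have "\<dots> = ((T + fps_const (1 / 2) * C) oo quad) * fps_deriv quad"
    by (simp only: C[folded T_def])
  also have "\<dots> = (T oo quad) * fps_deriv quad + fps_const (1 / 2) * fps_deriv quad * (C oo quad)"
    by (simp only: comp fps_const_compose) (simp only: algebra_simps)
  finally show ?thesis unfolding 1 .
qed

text \<open>If all coefficients below n vanish, \<open>quad * fps_deriv\<close> multiplies the n-th
  coefficient by n. The equation at index n - 1 then reads n^3 f_n = 0, so the constant term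
  determines the solution.\<close>

lemma ode_unique:
  fixes f :: "rat fps"
  assumes ode: "fps_deriv (quad * fps_deriv (quad * fps_deriv f))
           = quad * fps_deriv f + fps_const (1 / 2) * fps_deriv quad * f"
    and f0: "f $ 0 = 0"
  shows "f = 0"
proof (rule fps_ext)
  fix n
  show "f $ n = 0 $ n"
  proof (induction n rule: less_induct)
    case (less n)
    define low where "low = (\<lambda>g :: rat fps. \<forall>m<n. g $ m = 0)"
    show ?case
    proof (cases n)
      case 0 thus ?thesis using f0 by simp
    next
      case (Suc k)
      have lowf: "low f" using less by (simp add: low_def)
      have X: "low (quad * fps_deriv g) \<and> (quad * fps_deriv g) $ n = of_nat n * g $ n" if "low g" for g
      proof -
        have "quad * fps_deriv g = fps_X * fps_deriv g - fps_X * (fps_X * fps_deriv g)"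
          by (simp add: algebra_simps)
        thus ?thesis using that by (auto simp: low_def Suc)
      qed
      define u where "u = quad * fps_deriv f"
      have u: "low u" "u $ n = of_nat n * f $ n" using X[OF lowf] by (auto simp: u_def)
      define v where "v = quad * fps_deriv u"
      have v: "low v" "v $ n = of_nat n * u $ n" using X[OF u(1)] by (auto simp: v_def)
      have "fps_deriv v $ k = (u + fps_const (1 / 2) * (f - fps_const 2 * (fps_X * f))) $ k"
      proof -
        have "fps_deriv v = u + fps_const (1 / 2) * fps_deriv quad * f"
          unfolding v_def u_def by (rule ode)
        also have "fps_const (1 / 2) * fps_deriv quad * f = fps_const (1 / 2) * (f - fps_const 2 * (fps_X * f))"
          unfolding deriv_quad by (simp add: numeral_fps_const algebra_simps)
        finally show ?thesis by simp
      qed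
      moreover have "fps_deriv v $ k = of_nat n ^ 3 * f $ n"
        using u v by (simp add: Suc power3_eq_cube del: of_nat_Suc)
      moreover have "u $ k = 0" "f $ k = 0" "(fps_X * f) $ k = 0"
        using u lowf Suc by (auto simp: low_def)
      ultimately show ?thesis using Suc by simp
    qed
  qed
qed

lemma clausen: "sq_series * sq_series = cube_series oo quad"
proof -
  define f where "f = sq_series * sq_series - (cube_series oo quad)"
  have "f = 0"
  proof (rule ode_unique)
    show "f $ 0 = 0" by (simp add: f_def sq_series_def cube_series_def fps_compose_nth)
    show "fps_deriv (quad * fps_deriv (quad * fps_deriv f))
           = quad * fps_deriv f + fps_const (1 / 2) * fps_deriv quad * f"
      using square_ode[OF sq_series_ode] compose_quad_ode[OF cube_series_ode]
      unfolding f_def by (simp only: fps_deriv_sub right_diff_distrib) (simp only: algebra_simps)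
  qed
  thus ?thesis by (simp add: f_def)
qed

section \<open>Coefficients of Clausen's formula and their partial sums\<close>

lemma one_minus_X_power_nth: "((1 - fps_X) ^ k) $ j = ((- 1) ^ j * of_nat (k choose j) :: rat)"
proof (induction k arbitrary: j)
  case 0 thus ?case by (cases j) simp_all
next
  case (Suc k)
  have "(1 - fps_X) ^ Suc k = (1 - fps_X) ^ k - fps_X * (1 - fps_X :: rat fps) ^ k"
    by (simp add: algebra_simps)
  thus ?case using Suc by (cases j) (simp_all add: algebra_simps)
qed

text \<open>Multiplication by 1 - x takes differences of consecutive coefficients, so their partial
  sums telescope.\<close>

lemma sum_one_minus_X_mult_nth: "(\<Sum>n=0..N. ((1 - fps_X) * g) $ n) = (g $ N :: rat)"
  by (induction N) (simp_all add: algebra_simps)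

lemma sq_series_square_nth: "(sq_series * sq_series) $ n = of_nat (V n) / 16 ^ n"
proof -
  have "(sq_series * sq_series) $ n = (\<Sum>k=0..n. of_nat (((2 * k) choose k)\<^sup>2 * ((2 * n - 2 * k) choose (n - k))\<^sup>2) / 16 ^ n)"
    unfolding fps_mult_nth
  proof (rule sum.cong)
    fix k assume "k \<in> {0..n}"
    hence "(16 :: rat) ^ n = 16 ^ k * 16 ^ (n - k)" by (simp flip: power_add)
    thus "sq_series $ k * sq_series $ (n - k)
        = of_nat (((2 * k) choose k)\<^sup>2 * ((2 * n - 2 * k) choose (n - k))\<^sup>2) / 16 ^ n"
      by (simp add: sq_series_def diff_mult_distrib2)
  qed simp
  thus ?thesis by (simp add: V_def sum_divide_distrib)
qed

text \<open>For k > 0 the power \<open>quad ^ k\<close> contains a factor 1 - x. The sum of its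
  coefficients up to N is therefore a single one, that of x^N in x^k (1 - x)^(k - 1).\<close>

lemma sum_V:
  "(\<Sum>n=1..N. of_nat (V n) / 16 ^ n :: rat)
     = (\<Sum>k=1..N. of_nat ((2 * k) choose k) ^ 3 / 16 ^ k * ((- 1) ^ (N - k) * of_nat ((k - 1) choose (N - k))))"
proof -
  have Pk: "quad ^ k = (1 - fps_X) * (fps_X ^ k * (1 - fps_X) ^ (k - 1))" if "k \<ge> 1" for k
    using that by (cases k) (simp, simp only: power_mult_distrib power_Suc diff_Suc_1 ac_simps)
  have nth: "(sq_series * sq_series) $ n = (\<Sum>k=0..N. cube_series $ k * (quad ^ k) $ n)" if "n \<le> N" for n
  proof -
    have "(\<Sum>k=0..N. cube_series $ k * (quad ^ k) $ n) = (\<Sum>k=0..n. cube_series $ k * (quad ^ k) $ n)"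
      using that by (intro sum.mono_neutral_right) (auto simp: power_mult_distrib fps_X_power_mult_nth)
    thus ?thesis unfolding clausen fps_compose_nth by simp
  qed
  have "(\<Sum>n=0..N. of_nat (V n) / 16 ^ n :: rat) = (\<Sum>k=0..N. cube_series $ k * (\<Sum>n=0..N. (quad ^ k) $ n))"
    by (simp add: nth flip: sq_series_square_nth) (simp add: sum_distrib_left, rule sum.swap)
  also have "\<dots> = 1 + (\<Sum>k=1..N. cube_series $ k * (\<Sum>n=0..N. (quad ^ k) $ n))"
    by (subst sum.atLeast_Suc_atMost) (simp_all add: cube_series_def sum.delta)
  also have "(\<Sum>k=1..N. cube_series $ k * (\<Sum>n=0..N. (quad ^ k) $ n))
    = (\<Sum>k=1..N. of_nat ((2 * k) choose k) ^ 3 / 16 ^ k * ((- 1) ^ (N - k) * of_nat ((k - 1) choose (N - k))))"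
    by (intro sum.cong refl)
      (simp add: Pk sum_one_minus_X_mult_nth fps_X_power_mult_nth one_minus_X_power_nth cube_series_def)
  finally show ?thesis
    by (subst (asm) sum.atLeast_Suc_atMost) (simp_all add: V_def)
qed

section \<open>Identities for harmonic sums\<close>

definition harm :: "nat \<Rightarrow> nat \<Rightarrow> rat" where
  "harm r n = (\<Sum>k=1..n. 1 / of_nat k ^ r)"

definition odd_harm :: "nat \<Rightarrow> rat" where
  "odd_harm n = (\<Sum>k=1..n. 1 / (2 * of_nat k - 1))"

lemma harm_0 [simp]: "harm r 0 = 0" by (simp add: harm_def)

lemma harm_Suc [simp]: "harm r (Suc n) = harm r n + 1 / of_nat (Suc n) ^ r"
  by (simp add: harm_def del: of_nat_Suc)

lemma odd_harm_0 [simp]: "odd_harm 0 = 0" by (simp add: odd_harm_def)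

lemma odd_harm_Suc [simp]: "odd_harm (Suc n) = odd_harm n + 1 / (2 * of_nat n + 1)"
  by (simp add: odd_harm_def)

section \<open>Factorial ratios and the exact sum of \<open>q_term\<close>\<close>

text \<open>For \<open>m \<le> M\<close> this is the quotient of the binomial coefficients C(2M, M)
  and C(2M, M + m).\<close>

definition fact_ratio :: "nat \<Rightarrow> nat \<Rightarrow> rat" where
  "fact_ratio M m = fact (M + m) * fact (M - m) / fact M ^ 2"

lemma fact_ratio_0 [simp]: "fact_ratio M 0 = 1"
  by (simp add: fact_ratio_def power2_eq_square)

lemma fact_ratio_Suc_right:
  assumes "m < M"
  shows "fact_ratio M (Suc m) = fact_ratio M m * (of_nat M + of_nat m + 1) / (of_nat M - of_nat m)"
proof -
  obtain d where M: "M = m + Suc d" using assms less_imp_Suc_add by auto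
  show ?thesis unfolding M fact_ratio_def
    by (simp add: field_simps del: of_nat_Suc) (simp add: algebra_simps)
qed

text \<open>The new factor is (M + 1 + m)(M + 1 - m)/(M + 1)^2. Written as one minus a multiple of
  m^2, it cancels the weight 1/m^2 when differences in M are taken.\<close>

lemma fact_ratio_Suc_left:
  assumes "m \<le> M"
  shows "fact_ratio (Suc M) m = fact_ratio M m * (1 - of_nat m ^ 2 / of_nat (Suc M) ^ 2)"
proof -
  obtain d where M: "M = m + d" using assms le_Suc_ex by auto
  have *: "Suc (m + d) + m = Suc (m + d + m)" "Suc (m + d) - m = Suc d" by simp_all
  have **: "(1 - of_nat m ^ 2 / of_nat (Suc (m + d)) ^ 2 :: rat)
      = of_nat (Suc d) * of_nat (Suc (m + d + m)) / of_nat (Suc (m + d)) ^ 2"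
    by (simp add: divide_simps) (simp add: power2_eq_square algebra_simps)
  show ?thesis unfolding M ** unfolding fact_ratio_def * fact_Suc
    by (simp add: power_mult_distrib ac_simps del: of_nat_Suc)
qed

text \<open>Consecutive right-hand sides differ by twice a signed factorial ratio. With k = M + 1
  the right-hand side is k^2 times \<open>q_term n k\<close>.\<close>

lemma alternating_sum_fact_ratio:
  assumes "n \<le> M"
  shows "1 + 2 * (\<Sum>m=1..n. (- 1) ^ m * fact_ratio M m)
           = (- 1) ^ n * fact (M - n) * fact (Suc (M + n)) / (fact M * fact (Suc M))"
  using assms
proof (induction n)
  case (Suc n)
  then obtain d where M: "M = n + Suc d" using less_imp_Suc_add[of n M] by auto
  have "1 + 2 * (\<Sum>m=1..Suc n. (- 1) ^ m * fact_ratio M m)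
      = (- 1) ^ n * fact (M - n) * fact (Suc (M + n)) / (fact M * fact (Suc M))
        + 2 * ((- 1) ^ Suc n * fact_ratio M (Suc n))"
    using Suc by simp
  also have "\<dots> = (- 1) ^ Suc n * fact (M - Suc n) * fact (Suc (M + Suc n)) / (fact M * fact (Suc M))"
    unfolding fact_ratio_def M
    by (simp add: divide_simps del: of_nat_Suc) (simp add: power2_eq_square algebra_simps)
  finally show ?case .
qed simp

text \<open>Used only for \<open>n < k\<close> (the subtraction is truncated), as \<open>fact_ratio M m\<close> is only for
  \<open>m \<le> M\<close>. Up to the factor \<open>1 / k\<close> this is the derivative of
  \<open>\<Prod>i<k. (x + i) * (1 - x + i) / (i + 1)\<^sup>2\<close> at its simple zero \<open>x = - n\<close>.\<close>

definition q_term :: "nat \<Rightarrow> nat \<Rightarrow> rat" where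
  "q_term n k = (- 1) ^ n * fact (k - 1 - n) * fact (k + n) / (fact k ^ 2 * of_nat k)"

lemma q_term_eq:
  assumes "n \<le> M"
  shows "q_term n (Suc M) = (1 + 2 * (\<Sum>m=1..n. (- 1) ^ m * fact_ratio M m)) / of_nat (Suc M) ^ 2"
  unfolding alternating_sum_fact_ratio[OF assms] q_term_def
  by (simp add: power2_eq_square del: of_nat_Suc)

text \<open>Induction on M: by \<open>fact_ratio_Suc_left\<close> the weighted sum on the right
  loses the alternating sum divided by (M + 1)^2, which together with the increment of
  \<open>harm 2\<close> is the next \<open>q_term\<close>.\<close>

lemma sum_q_term:
  assumes "n \<le> M"
  shows "(\<Sum>k=Suc n..M. q_term n k)
     = harm 2 M - harm 2 n - 2 * (\<Sum>m=1..n. (- 1) ^ m * (fact_ratio M m - fact_ratio n m) / of_nat m ^ 2)"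
  using assms
proof (induction M rule: dec_induct)
  case (step M)
  have "fact_ratio (Suc M) m - fact_ratio n m
      = fact_ratio M m - fact_ratio n m - of_nat m ^ 2 * (fact_ratio M m / of_nat (Suc M) ^ 2)"
    if "m \<in> {1..n}" for m
    using that step by (subst fact_ratio_Suc_left) (simp_all add: algebra_simps)
  hence "(\<Sum>m=1..n. (- 1) ^ m * (fact_ratio (Suc M) m - fact_ratio n m) / of_nat m ^ 2)
      = (\<Sum>m=1..n. (- 1) ^ m * (fact_ratio M m - fact_ratio n m) / of_nat m ^ 2
          - (- 1) ^ m * fact_ratio M m / of_nat (Suc M) ^ 2)"
    by (intro sum.cong refl) (simp add: right_diff_distrib diff_divide_distrib del: of_nat_Suc)
  also have "\<dots> = (\<Sum>m=1..n. (- 1) ^ m * (fact_ratio M m - fact_ratio n m) / of_nat m ^ 2)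
        - (\<Sum>m=1..n. (- 1) ^ m * fact_ratio M m) / of_nat (Suc M) ^ 2"
    by (simp only: sum_subtractf sum_divide_distrib)
  finally show ?case
    using step q_term_eq[of n M] by (simp add: add_divide_distrib algebra_simps del: of_nat_Suc)
qed simp

section \<open>Convolutions and products of harmonic sums\<close>

lemma harm_convolution:
  "(\<Sum>m=1..n. harm 1 (n - m) / of_nat m ^ 2)
     = (\<Sum>s=1..n. harm 2 (s - 1) / of_nat s) + 2 * (\<Sum>s=1..n. harm 1 (s - 1) / of_nat s ^ 2)"
proof (induction n)
  case (Suc n)
  \<comment> \<open>Partial fractions for the increment 1/(n + 1 - m) of the inner harmonic
    number.\<close>
  have split: "1 / (of_nat (Suc n - m) * of_nat m ^ 2 :: rat)
      = 1 / of_nat m ^ 2 / of_nat (Suc n) + (1 / of_nat m ^ 1 + 1 / of_nat (Suc n - m) ^ 1) / of_nat (Suc n) ^ 2"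
    if m: "m \<in> {1..n}" for m
  proof -
    obtain d where n: "n = m + d" using m le_Suc_ex by auto
    have "Suc n - m = Suc d" "Suc n = m + Suc d" using n by simp_all
    moreover have "of_nat m \<noteq> (0 :: rat)" using m by simp
    ultimately show ?thesis
      by (simp only: of_nat_add) (simp add: divide_simps del: of_nat_Suc, simp add: power2_eq_square algebra_simps)
  qed
  have "(\<Sum>m=1..Suc n. harm 1 (Suc n - m) / of_nat m ^ 2)
      = (\<Sum>m=1..n. harm 1 (n - m) / of_nat m ^ 2 + 1 / (of_nat (Suc n - m) * of_nat m ^ 2))"
    by (simp add: Suc_diff_le add_divide_distrib del: of_nat_Suc)
  also have "\<dots> = (\<Sum>m=1..n. harm 1 (n - m) / of_nat m ^ 2 + (1 / of_nat m ^ 2 / of_nat (Suc n)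
      + (1 / of_nat m ^ 1 + 1 / of_nat (Suc n - m) ^ 1) / of_nat (Suc n) ^ 2))"
    by (intro sum.cong refl) (simp only: split)
  also have "\<dots> = (\<Sum>m=1..n. harm 1 (n - m) / of_nat m ^ 2)
      + (\<Sum>m=1..n. 1 / of_nat m ^ 2 / of_nat (Suc n) + (1 / of_nat m ^ 1 + 1 / of_nat (Suc n - m) ^ 1) / of_nat (Suc n) ^ 2)"
    by (rule sum.distrib)
  also have "(\<Sum>m=1..n. 1 / of_nat m ^ 2 / of_nat (Suc n) + (1 / of_nat m ^ 1 + 1 / of_nat (Suc n - m) ^ 1) / of_nat (Suc n) ^ 2)
      = harm 2 n / of_nat (Suc n) + (harm 1 n + (\<Sum>m=1..n. 1 / of_nat (Suc n - m) ^ 1)) / of_nat (Suc n) ^ 2"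
    unfolding harm_def by (simp only: sum.distrib sum_divide_distrib[symmetric])
  also have "(\<Sum>m=1..n. 1 / of_nat (Suc n - m) ^ 1) = harm 1 n"
    unfolding harm_def by (subst sum.atLeastAtMost_rev) simp
  finally show ?case using Suc by (simp del: of_nat_Suc)
qed simp

text \<open>The double sum over pairs of indices is split by which index is larger; the diagonal
  gives \<open>harm 3\<close>.\<close>

lemma harm_mult:
  "harm 1 n * harm 2 n
     = (\<Sum>s=1..n. harm 2 (s - 1) / of_nat s) + (\<Sum>s=1..n. harm 1 (s - 1) / of_nat s ^ 2) + harm 3 n"
  by (induction n)
    (simp_all add: algebra_simps power2_eq_square power3_eq_cube del: of_nat_Suc)

lemma harm_square: "(\<Sum>j=1..n. harm 1 j / of_nat j) = (harm 1 n ^ 2 + harm 2 n) / 2"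
  by (induction n)
    (simp_all add: algebra_simps power2_eq_square add_divide_distrib del: of_nat_Suc)

section \<open>Alternating binomial sums and Faulhaber's formula\<close>

text \<open>Pascal's rule, with C(n, k - 1) rewritten as k/(n + 1) times C(n + 1, k). The extra k
  lowers the exponent of a weight 1/k^r by one, so sums with such weights follow from those for r -
  1.\<close>

lemma alternating_binomial_step:
  fixes f :: "nat \<Rightarrow> rat"
  shows "(\<Sum>k=1..Suc n. (- 1) ^ Suc k * of_nat (Suc n choose k) * f k)
     = (\<Sum>k=1..n. (- 1) ^ Suc k * of_nat (n choose k) * f k)
       + (\<Sum>k=1..Suc n. (- 1) ^ Suc k * of_nat (Suc n choose k) * (of_nat k * f k)) / of_nat (Suc n)"
proof -
  have "(- 1) ^ Suc k * of_nat (Suc n choose k) * f k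
      = (- 1) ^ Suc k * of_nat (n choose k) * f k
        + (- 1) ^ Suc k * of_nat (Suc n choose k) * (of_nat k * f k) / of_nat (Suc n)"
    if "k \<in> {1..Suc n}" for k
  proof -
    obtain j where k: "k = Suc j" using \<open>k \<in> {1..Suc n}\<close> by (cases k) auto
    have "of_nat (Suc n choose k) * (of_nat k) = (of_nat (Suc n) * of_nat (n choose j) :: rat)"
      using arg_cong[OF Suc_times_binomial[of j n], of of_nat] unfolding k
      by (simp only: of_nat_mult mult.commute)
    hence "of_nat (Suc n choose k) * (of_nat k * f k) / of_nat (Suc n) = of_nat (n choose j) * f k"
      by (simp add: mult.assoc[symmetric] del: of_nat_Suc)
    hence "(- 1) ^ Suc k * of_nat (Suc n choose k) * (of_nat k * f k) / of_nat (Suc n)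
        = (- 1) ^ Suc k * (of_nat (n choose j) * f k)"
      by (simp only: times_divide_eq_right[symmetric] mult.assoc)
    moreover have "of_nat (Suc n choose k) = (of_nat (n choose j) + of_nat (n choose k) :: rat)"
      unfolding k by simp
    ultimately show ?thesis by (simp add: algebra_simps)
  qed
  then have "(\<Sum>k=1..Suc n. (- 1) ^ Suc k * of_nat (Suc n choose k) * f k)
     = (\<Sum>k=1..Suc n. (- 1) ^ Suc k * of_nat (n choose k) * f k
        + (- 1) ^ Suc k * of_nat (Suc n choose k) * (of_nat k * f k) / of_nat (Suc n))"
    by (intro sum.cong refl)
  also have "\<dots> = (\<Sum>k=1..Suc n. (- 1) ^ Suc k * of_nat (n choose k) * f k)
       + (\<Sum>k=1..Suc n. (- 1) ^ Suc k * of_nat (Suc n choose k) * (of_nat k * f k)) / of_nat (Suc n)"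
    by (simp only: sum.distrib sum_divide_distrib)
  also have "(\<Sum>k=1..Suc n. (- 1) ^ Suc k * of_nat (n choose k) * f k)
      = (\<Sum>k=1..n. (- 1) ^ Suc k * of_nat (n choose k) * f k)"
    by simp
  finally show ?thesis .
qed

lemma alternating_binomial_0:
  "(\<Sum>k=1..Suc n. (- 1) ^ Suc k * of_nat (Suc n choose k)) = (1 :: rat)"
proof -
  have "(\<Sum>k\<le>Suc n. (- 1) ^ k * of_nat (Suc n choose k)) = (0 :: rat)"
    using choose_alternating_sum[of "Suc n"] by simp
  hence "1 + (\<Sum>k=1..Suc n. (- 1) ^ k * of_nat (Suc n choose k)) = (0 :: rat)"
    unfolding atMost_atLeast0 by (subst (asm) sum.atLeast_Suc_atMost) (simp_all del: binomial_Suc_Suc)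
  thus ?thesis by (simp add: sum_negf del: binomial_Suc_Suc)
qed

lemma alternating_binomial_1:
  "(\<Sum>k=1..n. (- 1) ^ Suc k * of_nat (n choose k) * (1 / of_nat k)) = harm 1 n"
proof (induction n)
  case (Suc n)
  have "(\<Sum>k=1..Suc n. (- 1) ^ Suc k * of_nat (Suc n choose k) * (of_nat k * (1 / of_nat k))) = (1 :: rat)"
    by (subst alternating_binomial_0[of n, symmetric], intro sum.cong) auto
  thus ?case by (subst alternating_binomial_step) (simp only: Suc harm_Suc power_one_right)
qed simp

lemma alternating_binomial_2:
  "(\<Sum>k=1..n. (- 1) ^ Suc k * of_nat (n choose k) * (1 / of_nat k ^ 2)) = (\<Sum>j=1..n. harm 1 j / of_nat j)"
proof (induction n)
  case (Suc n)
  have "(\<Sum>k=1..Suc n. (- 1) ^ Suc k * of_nat (Suc n choose k) * (of_nat k * (1 / of_nat k ^ 2))) = harm 1 (Suc n)"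
    by (subst alternating_binomial_1[symmetric], intro sum.cong) (auto simp: power2_eq_square)
  from Suc this show ?case
    by (subst alternating_binomial_step) (simp only: sum.cl_ivl_Suc[of "\<lambda>j. harm 1 j / of_nat j"], simp)
qed simp

text \<open>Induction on j: the difference of the right-hand side between j and j + 1 is expanded
  binomially, and after exchanging the sums the inner one is the defining relation of the Bernoulli
  numbers. The range i < j matches the convention \<open>bernoulli 1 = - 1 / 2\<close>.\<close>

lemma faulhaber:
  "of_nat (Suc m) * (\<Sum>i<j. of_nat i ^ m)
     = (\<Sum>k\<le>m. of_nat (Suc m choose k) * bernoulli k * of_nat j ^ (Suc m - k))"
proof (induction j)
  case 0
  show ?case by (simp add: power_0_left)
next
  case (Suc j)
  let ?x = "of_nat j :: rat"
  have expand: "of_nat (Suc j) ^ n - ?x ^ n = (\<Sum>l<n. of_nat (n choose l) * ?x ^ l)" for n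
    using binomial_ring[of ?x 1 n] by (simp add: lessThan_Suc_atMost[symmetric] algebra_simps)
  \<comment> \<open>Both products are the trinomial coefficient with parts k, l and m + 1 - k -
    l.\<close>
  have choose: "(of_nat (Suc m choose k) * of_nat ((Suc m - k) choose l) :: rat)
      = of_nat (Suc m choose l) * of_nat ((Suc m - l) choose k)" if "k \<le> m" "l \<le> m - k" for k l
  proof -
    have "(Suc m choose k) * ((Suc m - k) choose l) = (Suc m choose l) * ((Suc m - l) choose k)"
    proof -
      have "(Suc m choose (k + l)) * ((k + l) choose k) = (Suc m choose k) * ((Suc m - k) choose l)"
        using that choose_mult[of k "k + l" "Suc m"] by simp
      moreover have "(Suc m choose (k + l)) * ((k + l) choose l) = (Suc m choose l) * ((Suc m - l) choose k)"
        using that choose_mult[of l "k + l" "Suc m"] by simp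
      moreover have "(k + l) choose k = (k + l) choose l"
        using binomial_symmetric[of k "k + l"] by simp
      ultimately show ?thesis by simp
    qed
    thus ?thesis by (simp only: of_nat_mult[symmetric])
  qed
  \<comment> \<open>For l = m only the term \<open>bernoulli 0 = 1\<close> is left; for smaller l
    the index m + 1 - l is at least 2 and the defining relation applies.\<close>
  have inner: "(\<Sum>k\<le>m - l. of_nat ((Suc m - l) choose k) * bernoulli k) = (if l = m then 1 else 0)"
    if "l \<le> m" for l
  proof (cases "l = m")
    case False
    thus ?thesis using that sum_binomial_bernoulli[of "Suc m - l"] by (simp add: atMost_atLeast0 Suc_diff_le)
  qed simp
  have "(\<Sum>k\<le>m. of_nat (Suc m choose k) * bernoulli k * of_nat (Suc j) ^ (Suc m - k))
      - (\<Sum>k\<le>m. of_nat (Suc m choose k) * bernoulli k * ?x ^ (Suc m - k))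
      = (\<Sum>k\<le>m. of_nat (Suc m choose k) * bernoulli k * (of_nat (Suc j) ^ (Suc m - k) - ?x ^ (Suc m - k)))"
    by (simp only: sum_subtractf right_diff_distrib)
  also have "\<dots> = (\<Sum>k\<le>m. \<Sum>l\<le>m - k. of_nat (Suc m choose l) * ?x ^ l * (of_nat ((Suc m - l) choose k) * bernoulli k))"
    unfolding expand
  proof (intro sum.cong refl)
    fix k assume k: "k \<in> {..m}"
    hence set: "{..<Suc m - k} = {..m - k}" by auto
    show "of_nat (Suc m choose k) * bernoulli k * (\<Sum>l<Suc m - k. of_nat ((Suc m - k) choose l) * ?x ^ l)
        = (\<Sum>l\<le>m - k. of_nat (Suc m choose l) * ?x ^ l * (of_nat ((Suc m - l) choose k) * bernoulli k))"
      unfolding set sum_distrib_left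
    proof (intro sum.cong refl)
      fix l assume "l \<in> {..m - k}"
      hence "(of_nat (Suc m choose k) * of_nat ((Suc m - k) choose l)) * (bernoulli k * ?x ^ l)
        = (of_nat (Suc m choose l) * of_nat ((Suc m - l) choose k)) * (bernoulli k * ?x ^ l)"
        using k by (subst choose) auto
      thus "of_nat (Suc m choose k) * bernoulli k * (of_nat ((Suc m - k) choose l) * ?x ^ l)
        = of_nat (Suc m choose l) * ?x ^ l * (of_nat ((Suc m - l) choose k) * bernoulli k)"
        by (simp only: ac_simps)
    qed
  qed
  also have "\<dots> = (\<Sum>l\<le>m. \<Sum>k\<le>m - l. of_nat (Suc m choose l) * ?x ^ l * (of_nat ((Suc m - l) choose k) * bernoulli k))"
    unfolding sum.Sigma[OF finite_atMost ballI[OF finite_atMost]]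
    by (rule sum.reindex_bij_witness[of _ "\<lambda>(l, k). (k, l)" "\<lambda>(k, l). (l, k)"]) auto
  also have "\<dots> = (\<Sum>l\<le>m. of_nat (Suc m choose l) * ?x ^ l * (if l = m then 1 else 0))"
    by (intro sum.cong refl) (simp only: sum_distrib_left[symmetric] inner atMost_iff)
  also have "\<dots> = of_nat (Suc m) * ?x ^ m"
    by (simp add: sum.delta if_distrib[of "\<lambda>x. _ * x"] cong: if_cong)
  finally show ?case using Suc by (simp add: distrib_left algebra_simps)
qed

section \<open>Congruences between rationals\<close>

locale odd_prime =
  fixes p :: nat
  assumes prime: "prime p" and odd: "odd p"
begin

abbreviation R :: "rat set" where "R \<equiv> p_integral p"

text \<open>The definition speaks of lowest terms. Allowing any fraction with denominator prime to p
  makes closure under sums and products a matter of multiplying denominators.\<close>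

lemma integral_iff: "x \<in> R \<longleftrightarrow> (\<exists>a b. \<not> int p dvd b \<and> x = of_int a / of_int b)"
proof
  obtain n d where q: "quotient_of x = (n, d)" by force
  have x: "x = of_int n / of_int d" using q by (rule quotient_of_div)
  assume "x \<in> R"
  hence "coprime d (int p)" by (simp add: p_integral_def q)
  hence "\<not> int p dvd d"
    using prime coprime_common_divisor[of d "int p" "int p"] by (auto simp: prime_nat_iff)
  thus "\<exists>a b. \<not> int p dvd b \<and> x = of_int a / of_int b" using x by blast
next
  assume "\<exists>a b. \<not> int p dvd b \<and> x = of_int a / of_int b"
  then obtain a b where b: "\<not> int p dvd b" and x: "x = of_int a / of_int b" by blast
  obtain n d where q: "quotient_of x = (n, d)" by force
  have d: "d > 0" using q by (rule quotient_of_denom_pos)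
  have "b \<noteq> 0" using b by auto
  have "of_int a / of_int b = (of_int n / of_int d :: rat)"
    using quotient_of_div[OF q] x by simp
  hence "of_int (a * d) = (of_int (n * b) :: rat)"
    using d \<open>b \<noteq> 0\<close> by (simp add: field_simps)
  hence "a * d = n * b" by (simp only: of_int_eq_iff)
  hence "d dvd n * b" by (metis dvd_triv_right)
  hence "d dvd b"
    using quotient_of_coprime[OF q] by (simp add: coprime_commute coprime_dvd_mult_right_iff)
  hence "\<not> int p dvd d" using b dvd_trans by blast
  hence "coprime d (int p)"
    using prime prime_imp_coprime[of "int p" d] by (simp add: coprime_commute)
  thus "x \<in> R" by (simp add: p_integral_def q)
qed

lemma p_gt_2: "p > 2"
  using prime odd prime_ge_2_nat[of p] by (cases "p = 2") auto

lemma integral_of_int [simp]: "of_int a \<in> R"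
  using prime unfolding integral_iff
  by (intro exI[of _ a] exI[of _ 1]) (auto simp: prime_nat_iff)

lemma integral_of_nat [simp]: "of_nat a \<in> R"
  using integral_of_int[of "int a"] by simp

lemma integral_numeral [simp]: "numeral a \<in> R" "0 \<in> R" "1 \<in> R"
  using integral_of_nat[of "numeral a"] integral_of_nat[of 0] integral_of_nat[of 1] by simp_all

lemma integral_mult [intro]: "x \<in> R \<Longrightarrow> y \<in> R \<Longrightarrow> x * y \<in> R"
proof -
  assume "x \<in> R" "y \<in> R"
  then obtain a b c d where "\<not> int p dvd b" "x = of_int a / of_int b"
      "\<not> int p dvd d" "y = of_int c / of_int d"
    unfolding integral_iff by blast
  thus ?thesis unfolding integral_iff using prime
    by (intro exI[of _ "a * c"] exI[of _ "b * d"]) (auto simp: prime_dvd_mult_iff)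
qed

lemma integral_add [intro]: "x \<in> R \<Longrightarrow> y \<in> R \<Longrightarrow> x + y \<in> R"
proof -
  assume "x \<in> R" "y \<in> R"
  then obtain a b c d where *: "\<not> int p dvd b" "x = of_int a / of_int b"
      "\<not> int p dvd d" "y = of_int c / of_int d"
    unfolding integral_iff by blast
  hence "b \<noteq> 0" "d \<noteq> 0" by auto
  thus ?thesis unfolding integral_iff using prime *
    by (intro exI[of _ "a * d + c * b"] exI[of _ "b * d"]) (auto simp: prime_dvd_mult_iff field_simps)
qed

lemma integral_minus [intro]: "x \<in> R \<Longrightarrow> - x \<in> R"
  using integral_mult[of "of_int (-1)" x] integral_of_int[of "-1"] by simp

lemma integral_diff [intro]: "x \<in> R \<Longrightarrow> y \<in> R \<Longrightarrow> x - y \<in> R"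
  using integral_add[of x "- y"] by auto

lemma integral_power [intro]: "x \<in> R \<Longrightarrow> x ^ n \<in> R"
  by (induction n) auto

lemma integral_sum [intro]: "(\<And>i. i \<in> A \<Longrightarrow> f i \<in> R) \<Longrightarrow> sum f A \<in> R"
  by (induction A rule: infinite_finite_induct) auto

lemma integral_inverse_int: "\<not> int p dvd a \<Longrightarrow> 1 / of_int a \<in> R"
  unfolding integral_iff by (intro exI[of _ 1] exI[of _ a]) auto

lemma integral_inverse_nat: "\<not> p dvd n \<Longrightarrow> 1 / of_nat n \<in> R"
  using integral_inverse_int[of "int n"] by simp

lemma integral_inverse_less: "0 < n \<Longrightarrow> n < p \<Longrightarrow> 1 / of_nat n \<in> R"
  by (rule integral_inverse_nat) (auto dest: dvd_imp_le)

lemma integral_divide_less: "x \<in> R \<Longrightarrow> 0 < n \<Longrightarrow> n < p \<Longrightarrow> x / of_nat n ^ k \<in> R"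
  using integral_mult[OF _ integral_power[OF integral_inverse_less[of n]], of x k]
  by (simp add: power_one_over)

lemma integral_inverse_diff: "0 < n \<Longrightarrow> n < p \<Longrightarrow> 1 / (of_nat p - of_nat n) \<in> R"
  using integral_inverse_less[of "p - n"] by (simp add: of_nat_diff)

lemma integral_half: "x \<in> R \<Longrightarrow> x / 2 \<in> R"
  using integral_divide_less[of x 2 1] p_gt_2 by simp

text \<open>Halving twice covers p = 3 as well, where 4 is not below p.\<close>

lemma integral_divide_4_power: "x \<in> R \<Longrightarrow> x / 4 ^ n \<in> R"
proof (induction n arbitrary: x)
  case (Suc n)
  have "x / 4 ^ Suc n = x / 2 / 2 / 4 ^ n" by simp
  thus ?case using Suc.IH[OF integral_half[OF integral_half[OF Suc.prems]]] by simp
qed simp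

section \<open>Calculus of congruences modulo powers of p\<close>

text \<open>Only the difference is constrained, so congruences add without side conditions;
  integrality passes from one side to the other by \<open>eqmod_integral\<close>. The modulus is
  recorded by its exponent.\<close>

definition eqmod :: "nat \<Rightarrow> rat \<Rightarrow> rat \<Rightarrow> bool" where
  "eqmod k x y \<longleftrightarrow> (\<exists>z\<in>R. x - y = of_nat p ^ k * z)"

lemma eqmodI: "z \<in> R \<Longrightarrow> x - y = of_nat p ^ k * z \<Longrightarrow> eqmod k x y"
  unfolding eqmod_def by blast

lemma eqmod_refl [simp]: "eqmod k x x"
  by (rule eqmodI[of 0]) simp_all

lemma eqmod_add: "eqmod k x y \<Longrightarrow> eqmod k x' y' \<Longrightarrow> eqmod k (x + x') (y + y')"
proof -
  assume "eqmod k x y" "eqmod k x' y'"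
  then obtain z z' where "z \<in> R" "z' \<in> R" "x - y = of_nat p ^ k * z" "x' - y' = of_nat p ^ k * z'"
    unfolding eqmod_def by blast
  thus ?thesis by (intro eqmodI[of "z + z'"]) (auto simp: algebra_simps)
qed

lemma eqmod_mult_left: "a \<in> R \<Longrightarrow> eqmod k x y \<Longrightarrow> eqmod k (a * x) (a * y)"
proof -
  assume "a \<in> R" "eqmod k x y"
  then obtain z where "z \<in> R" "x - y = of_nat p ^ k * z"
    unfolding eqmod_def by blast
  thus ?thesis using \<open>a \<in> R\<close>
    by (intro eqmodI[of "a * z"]) (auto simp: right_diff_distrib[symmetric])
qed

lemma eqmod_mult_right: "a \<in> R \<Longrightarrow> eqmod k x y \<Longrightarrow> eqmod k (x * a) (y * a)"
  using eqmod_mult_left by (simp add: mult.commute)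

lemma eqmod_minus: "eqmod k x y \<Longrightarrow> eqmod k (- x) (- y)"
  using eqmod_mult_left[OF integral_minus[of 1], of k x y] by simp

lemma eqmod_diff: "eqmod k x y \<Longrightarrow> eqmod k x' y' \<Longrightarrow> eqmod k (x - x') (y - y')"
  using eqmod_add[OF _ eqmod_minus, of k x y x' y'] by simp

lemma eqmod_sym: "eqmod k x y \<Longrightarrow> eqmod k y x"
  using eqmod_diff[OF eqmod_refl eqmod_minus, of k x y 0] eqmod_minus[of k x y]
  unfolding eqmod_def by simp

lemma eqmod_trans [trans]: "eqmod k x y \<Longrightarrow> eqmod k y z \<Longrightarrow> eqmod k x z"
  using eqmod_add[of k x y y z] unfolding eqmod_def by (simp add: algebra_simps)

text \<open>The general substitution rules of calculational reasoning diverge on chains that mix \<open>=\<close>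
  and \<open>eqmod\<close>.\<close>

lemma eqmod_trans_eq [trans]: "eqmod k x y \<Longrightarrow> y = z \<Longrightarrow> eqmod k x z"
  by simp

lemma eq_eqmod_trans [trans]: "x = y \<Longrightarrow> eqmod k y z \<Longrightarrow> eqmod k x z"
  by simp

lemma eqmod_mult:
  assumes "x \<in> R" "y' \<in> R" "eqmod k x y" "eqmod k x' y'"
  shows "eqmod k (x * x') (y * y')"
  using eqmod_trans[OF eqmod_mult_left[OF assms(1,4)] eqmod_mult_right[OF assms(2,3)]] .

lemma eqmod_sum: "(\<And>i. i \<in> A \<Longrightarrow> eqmod k (f i) (g i)) \<Longrightarrow> eqmod k (sum f A) (sum g A)"
  by (induction A rule: infinite_finite_induct) (auto intro: eqmod_add)

text \<open>A factor p^j raises the precision: quantities carrying it need to be compared only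
  modulo the lower power.\<close>

lemma eqmod_scale:
  assumes "eqmod k x y" "l = k + j"
  shows "eqmod l (of_nat p ^ j * x) (of_nat p ^ j * y)"
proof -
  obtain z where "z \<in> R" "x - y = of_nat p ^ k * z"
    using assms unfolding eqmod_def by blast
  thus ?thesis
    by (intro eqmodI[of z]) (auto simp: assms(2) right_diff_distrib[symmetric] power_add)
qed

lemma eqmod_integral: "eqmod k x y \<Longrightarrow> y \<in> R \<Longrightarrow> x \<in> R"
proof -
  assume "eqmod k x y" "y \<in> R"
  then obtain z where "z \<in> R" "x = y + of_nat p ^ k * z"
    unfolding eqmod_def by (auto simp: algebra_simps)
  thus ?thesis using \<open>y \<in> R\<close> by (auto intro!: integral_add integral_mult integral_power)
qed

lemma eqmod_mono: "eqmod k x y \<Longrightarrow> l \<le> k \<Longrightarrow> eqmod l x y"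
proof -
  assume "eqmod k x y" "l \<le> k"
  then obtain z where "z \<in> R" "x - y = of_nat p ^ (l + (k - l)) * z"
    unfolding eqmod_def by auto
  thus ?thesis
    by (intro eqmodI[of "of_nat p ^ (k - l) * z"]) (auto simp: power_add intro!: integral_mult integral_power)
qed

section \<open>Expansions of inverse powers of p - a\<close>

lemma inverse_minus_mod_p:
  assumes "0 < a" "a < p"
  shows "eqmod 1 (1 / (of_nat p - of_nat a)) (- 1 / of_nat a)"
proof (rule eqmodI)
  show "1 / (of_nat p - of_nat a) * (1 / of_nat a) \<in> R"
    using assms by (intro integral_mult integral_inverse_diff integral_inverse_less)
  show "1 / (of_nat p - of_nat a) - - 1 / of_nat a = of_nat p ^ 1 * (1 / (of_nat p - of_nat a) * (1 / of_nat a) :: rat)"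
    using assms by (simp add: field_simps)
qed

lemma inverse_minus_power_mod_p:
  assumes "0 < a" "a < p"
  shows "eqmod 1 (1 / (of_nat p - of_nat a) ^ n) ((- 1) ^ n / of_nat a ^ n)"
proof (induction n)
  case (Suc n)
  have "eqmod 1 (1 / (of_nat p - of_nat a) * (1 / (of_nat p - of_nat a) ^ n))
      (- 1 / of_nat a * ((- 1) ^ n / of_nat a ^ n))"
    using assms Suc
    by (intro eqmod_mult inverse_minus_mod_p integral_inverse_diff)
      (auto intro!: integral_divide_less integral_power integral_minus)
  thus ?case by simp
qed simp

text \<open>The expansion of 1/(a - p)^2 in p to first order; the exact remainder is p^2 (3a -
  2p)/((p - a)^2 a^3).\<close>

lemma inverse_minus_square_mod_p2:
  assumes "0 < a" "a < p"
  shows "eqmod 2 (1 / (of_nat p - of_nat a) ^ 2) (1 / of_nat a ^ 2 + 2 * of_nat p / of_nat a ^ 3)"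
proof (rule eqmodI)
  let ?z = "(3 * of_nat a - 2 * of_nat p) * (1 / (of_nat p - of_nat a)) ^ 2 / of_nat a ^ 3 :: rat"
  show "?z \<in> R"
    using assms by (intro integral_divide_less integral_mult integral_power integral_inverse_diff integral_diff) auto
  define d :: rat where "d = of_nat p - of_nat a"
  have d: "d \<noteq> 0" "of_nat a \<noteq> (0 :: rat)" "of_nat p = d + of_nat a" using assms by (auto simp: d_def)
  show "1 / (of_nat p - of_nat a) ^ 2 - (1 / of_nat a ^ 2 + 2 * of_nat p / of_nat a ^ 3) = of_nat p ^ 2 * ?z"
    unfolding d(3) using d(1,2) by (simp add: divide_simps) (simp add: eval_nat_numeral algebra_simps)
qed

section \<open>Harmonic sums modulo powers of p\<close>

definition h :: nat where "h = (p - 1) div 2"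

lemma p_eq: "p = 2 * h + 1"
  using odd p_gt_2 by (auto simp: h_def elim!: oddE)

lemma p_minus_1: "p - 1 = 2 * h" and p_minus_1_h: "p - 1 - h = h"
  using p_eq by linarith+

lemma of_nat_p_eq: "(of_nat p :: rat) = 2 * of_nat h + 1"
  by (subst p_eq) simp

lemma harm_integral: "n < p \<Longrightarrow> harm r n \<in> R"
  unfolding harm_def by (auto intro!: integral_divide_less)

lemma odd_harm_integral: "n \<le> h \<Longrightarrow> odd_harm n \<in> R"
proof (induction n)
  case (Suc n)
  have "1 / of_nat (2 * n + 1) \<in> R"
    using Suc.prems p_eq by (intro integral_inverse_less) auto
  thus ?case using Suc by (auto intro!: integral_add simp: add.commute)
qed simp

lemma sum_split_half:
  fixes f :: "nat \<Rightarrow> rat"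
  shows "(\<Sum>k=1..p - 1. f k) = (\<Sum>k=1..h. f k) + (\<Sum>m=1..h. f (p - m))"
proof -
  have "(\<Sum>k=1..p - 1. f k) = (\<Sum>k=1..h. f k) + (\<Sum>k=Suc h..p - 1. f k)"
    unfolding p_minus_1 mult_2 using sum.ub_add_nat[of 1 h f h] by simp
  also have "(\<Sum>k=Suc h..p - 1. f k) = (\<Sum>m=1..h. f (p - m))"
    using p_eq by (intro sum.reindex_bij_witness[of _ "\<lambda>m. p - m" "\<lambda>m. p - m"]) auto
  finally show ?thesis .
qed

text \<open>The odd numbers below p are the numbers p - 2m with m from 1 to h.\<close>

lemma sum_split_parity:
  fixes f :: "nat \<Rightarrow> rat"
  shows "(\<Sum>k=1..p - 1. f k) = (\<Sum>m=1..h. f (2 * m)) + (\<Sum>m=1..h. f (p - 2 * m))"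
proof -
  have *: "(\<Sum>k=1..2 * n. f k) = (\<Sum>m=1..n. f (2 * m)) + (\<Sum>m=1..n. f (2 * m - 1))" for n
    by (induction n) (simp_all add: algebra_simps)
  have "(\<Sum>m=1..h. f (2 * m - 1)) = (\<Sum>m=1..h. f (p - 2 * m))"
    using p_eq by (intro sum.reindex_bij_witness[of _ "\<lambda>m. h + 1 - m" "\<lambda>m. h + 1 - m"]) (auto simp: algebra_simps)
  thus ?thesis using *[of h] unfolding p_minus_1 by simp
qed

lemma harm_reflect:
  "n < p \<Longrightarrow> harm r (p - 1) = harm r (p - 1 - n) + (\<Sum>m=1..n. 1 / (of_nat p - of_nat m) ^ r)"
proof (induction n)
  case (Suc n)
  have "p - 1 - n = Suc (p - 1 - Suc n)" using Suc.prems by simp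
  hence "harm r (p - 1 - n) = harm r (p - 1 - Suc n) + 1 / of_nat (p - 1 - n) ^ r"
    by (metis harm_Suc)
  moreover have "(of_nat (p - 1 - n) :: rat) = of_nat p - of_nat (Suc n)"
    using Suc.prems by (simp add: of_nat_diff)
  ultimately show ?case using Suc by simp
qed simp

text \<open>Replacing m by p - m shows that the sum is congruent to its own negative, and 2 is
  invertible.\<close>

lemma harm_odd_mod_p:
  assumes "Parity.odd r"
  shows "eqmod 1 (harm r (p - 1)) 0"
proof -
  have "harm r (p - 1) = (\<Sum>m=1..p - 1. 1 / (of_nat p - of_nat m) ^ r)"
    using harm_reflect[of "p - 1" r] p_gt_2 by simp
  also have "eqmod 1 \<dots> (\<Sum>m=1..p - 1. (- 1) ^ r / of_nat m ^ r)"
    by (intro eqmod_sum inverse_minus_power_mod_p) auto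
  also have "(\<Sum>m=1..p - 1. (- 1) ^ r / of_nat m ^ r) = - harm r (p - 1)"
    using assms by (simp add: harm_def sum_negf)
  finally have "eqmod 1 (1 / 2 * (harm r (p - 1) + harm r (p - 1))) (1 / 2 * (- harm r (p - 1) + harm r (p - 1)))"
    by (intro eqmod_mult_left eqmod_add integral_half) simp_all
  thus ?thesis by simp
qed

lemma harm_1_reflect_mod_p:
  assumes "n < p"
  shows "eqmod 1 (harm 1 (p - 1 - n)) (harm 1 n)"
proof -
  have "harm 1 (p - 1 - n) = harm 1 (p - 1) - (\<Sum>m=1..n. 1 / (of_nat p - of_nat m) ^ 1)"
    using harm_reflect[OF assms, of 1] by simp
  also have "eqmod 1 \<dots> (0 - (\<Sum>m=1..n. (- 1) ^ 1 / of_nat m ^ 1))"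
    using assms by (intro eqmod_diff eqmod_sum inverse_minus_power_mod_p harm_odd_mod_p) auto
  finally show ?thesis by (simp add: harm_def sum_negf)
qed

text \<open>Pairs m with p - m. Together with \<open>harm_2_parity\<close>, which splits the same
  sum by parity, this gives two relations that allow \<open>harm 2 h\<close> and
  \<open>harm 3 h\<close> to be eliminated.\<close>

lemma harm_2_half:
  "eqmod 2 (harm 2 (p - 1)) (2 * harm 2 h + 2 * of_nat p * harm 3 h)"
proof -
  have "harm 2 (p - 1) = harm 2 h + (\<Sum>m=1..h. 1 / (of_nat p - of_nat m) ^ 2)"
    using harm_reflect[of h 2] p_eq unfolding p_minus_1_h by linarith
  also have "eqmod 2 \<dots> (harm 2 h + (\<Sum>m=1..h. 1 / of_nat m ^ 2 + 2 * of_nat p / of_nat m ^ 3))"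
    using p_eq by (intro eqmod_add eqmod_sum inverse_minus_square_mod_p2 eqmod_refl) auto
  also have "\<dots> = 2 * harm 2 h + 2 * of_nat p * harm 3 h"
    by (simp add: harm_def sum.distrib sum_distrib_left)
  finally show ?thesis .
qed

lemma harm_2_parity:
  "eqmod 2 (harm 2 (p - 1)) (harm 2 h / 2 + of_nat p * harm 3 h / 4)"
proof -
  have "harm 2 (p - 1) = (\<Sum>m=1..h. 1 / of_nat (2 * m) ^ 2) + (\<Sum>m=1..h. 1 / of_nat (p - 2 * m) ^ 2)"
    unfolding harm_def by (rule sum_split_parity)
  also have "(\<Sum>m=1..h. 1 / of_nat (p - 2 * m) ^ 2 :: rat) = (\<Sum>m=1..h. 1 / (of_nat p - of_nat (2 * m)) ^ 2)"
    using p_eq by (intro sum.cong refl) (subst of_nat_diff, auto)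
  also have "eqmod 2 ((\<Sum>m=1..h. 1 / of_nat (2 * m) ^ 2) + \<dots>)
      ((\<Sum>m=1..h. 1 / of_nat (2 * m) ^ 2)
        + (\<Sum>m=1..h. 1 / of_nat (2 * m) ^ 2 + 2 * of_nat p / of_nat (2 * m) ^ 3))"
    using p_eq by (intro eqmod_add eqmod_sum inverse_minus_square_mod_p2 eqmod_refl) auto
  also have "\<dots> = harm 2 h / 2 + of_nat p * harm 3 h / 4"
    by (simp add: harm_def sum.distrib sum_distrib_left sum_divide_distrib power_mult_distrib mult.commute flip: sum.distrib)
  finally show ?thesis .
qed

text \<open>The left-hand side is the product of 1 - p/k over k from 1 to n, of which only the part
  linear in p survives modulo p^2.\<close>

lemma binomial_p_minus_1:
  "n < p \<Longrightarrow> eqmod 2 ((- 1) ^ n * of_nat ((p - 1) choose n)) (1 - of_nat p * harm 1 n)"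
proof (induction n)
  case (Suc n)
  let ?b = "(- 1) ^ n * of_nat ((p - 1) choose n) :: rat"
  let ?c = "1 - of_nat p * (1 / of_nat (Suc n)) :: rat"
  have "Suc n * ((p - 1) choose Suc n) = (p - 1 - n) * ((p - 1) choose n)"
    by (simp only: binomial_absorption binomial_absorb_comp)
  hence "of_nat (Suc n) * of_nat ((p - 1) choose Suc n) = ((of_nat p - of_nat (Suc n)) * of_nat ((p - 1) choose n) :: rat)"
    using Suc.prems by (subst of_nat_mult[symmetric]) (simp add: of_nat_diff)
  hence C: "of_nat ((p - 1) choose Suc n) = - ?c * of_nat ((p - 1) choose n)"
    by (simp add: field_simps del: of_nat_Suc)
  have "(- 1) ^ Suc n * of_nat ((p - 1) choose Suc n) = ?b * ?c"
    unfolding C by (simp add: algebra_simps del: of_nat_Suc)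
  also have "eqmod 2 \<dots> ((1 - of_nat p * harm 1 n) * ?c)"
    using Suc by (intro eqmod_mult_right integral_diff integral_mult integral_inverse_less) auto
  also have "eqmod 2 \<dots> (1 - of_nat p * harm 1 (Suc n))"
  proof (rule eqmodI)
    show "harm 1 n * (1 / of_nat (Suc n)) \<in> R"
      using Suc.prems by (intro integral_mult harm_integral integral_inverse_less) auto
  qed (simp add: algebra_simps power2_eq_square del: of_nat_Suc)
  finally show ?case .
qed simp

definition double_harm :: rat where "double_harm = (\<Sum>j=1..p - 1. harm 1 (j - 1) / of_nat j ^ 2)"

text \<open>The identities \<open>alternating_binomial_2\<close> and \<open>harm_square\<close> are
  taken at n = p - 1, and the binomial coefficients are expanded modulo p^2.\<close>

lemma double_harm_mod_p2: "eqmod 2 (of_nat p * double_harm) (3 / 2 * harm 2 (p - 1))"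
proof -
  let ?S = "\<Sum>k=1..p - 1. harm 1 k / of_nat k ^ 2"
  have "harm 1 k / of_nat k ^ 2 = harm 1 (k - 1) / of_nat k ^ 2 + 1 / of_nat k ^ 3" if "k \<in> {1..p - 1}" for k
    using that by (cases k) (simp_all add: add_divide_distrib power2_eq_square power3_eq_cube del: of_nat_Suc)
  hence S: "?S = double_harm + harm 3 (p - 1)"
    unfolding double_harm_def harm_def[of 3] by (simp add: sum.distrib)
  have "(harm 1 (p - 1) ^ 2 + harm 2 (p - 1)) / 2
      = (\<Sum>k=1..p - 1. - (((- 1) ^ k * of_nat ((p - 1) choose k)) * (1 / of_nat k ^ 2)))"
    unfolding harm_square[symmetric] alternating_binomial_2[symmetric] by simp
  also have "eqmod 2 \<dots> (\<Sum>k=1..p - 1. - ((1 - of_nat p * harm 1 k) * (1 / of_nat k ^ 2)))"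
    by (intro eqmod_sum eqmod_minus eqmod_mult_right binomial_p_minus_1 integral_divide_less) auto
  also have "\<dots> = of_nat p * ?S - harm 2 (p - 1)"
    by (simp add: harm_def[of 2] sum_distrib_left algebra_simps diff_divide_distrib flip: sum_subtractf)
  finally obtain z where z: "z \<in> R"
      "(harm 1 (p - 1) ^ 2 + harm 2 (p - 1)) / 2 - (of_nat p * (double_harm + harm 3 (p - 1)) - harm 2 (p - 1)) = of_nat p ^ 2 * z"
    unfolding S eqmod_def by blast
  \<comment> \<open>Both sums are divisible by p, so the square of the first and p times the second
    vanish modulo p^2.\<close>
  obtain u v where uv: "u \<in> R" "v \<in> R" "harm 1 (p - 1) = of_nat p * u" "harm 3 (p - 1) = of_nat p * v"
    using harm_odd_mod_p[of 1] harm_odd_mod_p[of 3] unfolding eqmod_def by auto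
  show ?thesis
  proof (rule eqmodI)
    show "u ^ 2 / 2 - v - z \<in> R"
      using uv z by (intro integral_diff integral_half integral_power)
    show "of_nat p * double_harm - 3 / 2 * harm 2 (p - 1) = of_nat p ^ 2 * (u ^ 2 / 2 - v - z)"
      using z(2) unfolding uv by (simp add: field_simps power2_eq_square)
  qed
qed

text \<open>In the upper half j = p - m; there the inner harmonic number reflects to
  \<open>harm 1 m\<close> and the square of p - m to m^2.\<close>

lemma double_harm_half: "eqmod 1 double_harm (2 * (\<Sum>s=1..h. harm 1 (s - 1) / of_nat s ^ 2) + harm 3 h)"
proof -
  have "double_harm = (\<Sum>j=1..h. harm 1 (j - 1) / of_nat j ^ 2) + (\<Sum>m=1..h. harm 1 (p - 1 - m) * (1 / (of_nat p - of_nat m) ^ 2))"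
    unfolding double_harm_def sum_split_half using p_eq
    by (intro arg_cong2[of _ _ _ _ "(+)"] sum.cong refl) (auto simp: of_nat_diff)
  also have "eqmod 1 \<dots> ((\<Sum>j=1..h. harm 1 (j - 1) / of_nat j ^ 2) + (\<Sum>m=1..h. harm 1 m * ((- 1) ^ 2 / of_nat m ^ 2)))"
    using p_eq
    by (intro eqmod_add eqmod_refl eqmod_sum eqmod_mult harm_1_reflect_mod_p inverse_minus_power_mod_p harm_integral)
      (auto intro!: integral_divide_less)
  also have "(\<Sum>m=1..h. harm 1 m * ((- 1) ^ 2 / of_nat m ^ 2)) = (\<Sum>m=1..h. harm 1 (m - 1) / of_nat m ^ 2 + 1 / of_nat m ^ 3)"
  proof (intro sum.cong refl)
    fix m assume "m \<in> {1..h}"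
    thus "harm 1 m * ((- 1) ^ 2 / of_nat m ^ 2) = harm 1 (m - 1) / of_nat m ^ 2 + 1 / of_nat m ^ 3"
      by (cases m) (simp_all add: add_divide_distrib power2_eq_square power3_eq_cube del: of_nat_Suc)
  qed
  finally show ?thesis by (simp add: sum.distrib harm_def[of 3] algebra_simps)
qed

text \<open>Since 2k - 1 = p - 2(h + 1 - k), odd reciprocals become negated halves of the
  reciprocals of h, h - 1, and so on downwards.\<close>

lemma odd_harm_mod_p:
  "n \<le> h \<Longrightarrow> eqmod 1 (odd_harm n) ((harm 1 (h - n) - harm 1 h) / 2)"
proof (induction n)
  case (Suc n)
  define d where "d = h - Suc n"
  have d: "h - n = Suc d" "h - Suc n = d" "h = n + Suc d" using Suc.prems by (simp_all add: d_def)
  have "eqmod 1 (1 / (2 * of_nat n + 1)) (- 1 / (2 * of_nat (Suc d)))"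
  proof (rule eqmodI)
    show "1 / of_nat (2 * n + 1) * (1 / of_nat (2 * Suc d)) \<in> R"
      using p_eq d by (intro integral_mult integral_inverse_less) auto
    have "(2 * of_nat n + 1 :: rat) \<noteq> 0" by (metis of_nat_1 of_nat_add of_nat_mult of_nat_numeral of_nat_eq_0_iff add_is_0 one_neq_zero)
    thus "1 / (2 * of_nat n + 1) - - 1 / (2 * of_nat (Suc d))
        = of_nat p ^ 1 * (1 / of_nat (2 * n + 1) * (1 / of_nat (2 * Suc d)) :: rat)"
      unfolding of_nat_p_eq d(3) by (simp add: field_simps)
  qed
  hence "eqmod 1 (odd_harm n + 1 / (2 * of_nat n + 1)) ((harm 1 (h - n) - harm 1 h) / 2 + - 1 / (2 * of_nat (Suc d)))"
    using Suc by (intro eqmod_add) auto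
  also have "(harm 1 (h - n) - harm 1 h) / 2 + - 1 / (2 * of_nat (Suc d)) = (harm 1 (h - Suc n) - harm 1 h) / 2"
    unfolding d(1,2) by (simp add: add_divide_distrib diff_divide_distrib del: of_nat_Suc)
  finally show ?case by simp
qed simp

text \<open>By \<open>odd_harm_mod_p\<close> the sum becomes a convolution minus a product of
  harmonic numbers. After both are expanded, the sums \<open>?Q\<close> cancel and
  \<open>double_harm_half\<close> applies.\<close>

lemma sum_odd_harm:
  "eqmod 1 (4 * (\<Sum>m=1..h. odd_harm m / of_nat m ^ 2)) (double_harm - 3 * harm 3 h)"
proof -
  let ?Z = "\<Sum>s=1..h. harm 1 (s - 1) / of_nat s ^ 2"
  let ?Q = "\<Sum>s=1..h. harm 2 (s - 1) / of_nat s"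
  have hp: "h < p" using p_eq by simp
  have "eqmod 1 (4 * (\<Sum>m=1..h. odd_harm m * (1 / of_nat m ^ 2)))
      (4 * (\<Sum>m=1..h. (harm 1 (h - m) - harm 1 h) / 2 * (1 / of_nat m ^ 2)))"
    using hp by (intro eqmod_mult_left eqmod_sum eqmod_mult_right odd_harm_mod_p integral_divide_less) auto
  also have "4 * (\<Sum>m=1..h. (harm 1 (h - m) - harm 1 h) / 2 * (1 / of_nat m ^ 2))
      = 2 * (\<Sum>m=1..h. harm 1 (h - m) / of_nat m ^ 2) - 2 * harm 1 h * harm 2 h"
    by (simp add: harm_def[of 2] sum_distrib_left diff_divide_distrib algebra_simps flip: sum_subtractf)
  also have "\<dots> = (2 * ?Z + harm 3 h) - 3 * harm 3 h"
    unfolding harm_convolution mult.assoc harm_mult by (simp add: algebra_simps)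
  also have "eqmod 1 \<dots> (double_harm - 3 * harm 3 h)"
    by (intro eqmod_diff eqmod_sym[OF double_harm_half] eqmod_refl)
  finally show ?thesis by simp
qed

section \<open>Factorial ratios modulo p^2 and the sum of \<open>q_term\<close>\<close>

text \<open>A factor p is present from m = 1 on, so each further factor -(p + m)/(p - m - 1) counts
  only modulo p, as m/(m + 1).\<close>

lemma fact_ratio_p_minus_1:
  assumes "1 \<le> m" "m \<le> h"
  shows "eqmod 2 ((- 1) ^ m * fact_ratio (p - 1) m) (of_nat p / of_nat m)"
  using assms
proof (induction m rule: nat_induct_at_least)
  case base
  have "fact_ratio (p - 1) 1 = of_nat p * (1 / (of_nat p - of_nat 1))"
    using fact_ratio_Suc_right[of 0 "p - 1"] p_gt_2 by (simp add: of_nat_diff)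
  moreover have "of_nat p \<noteq> (1 :: rat)" using p_gt_2 by simp
  ultimately show ?case
    using p_gt_2 integral_inverse_diff[of 1]
    by (intro eqmodI[of "- (1 / (of_nat p - of_nat 1))"])
      (auto simp: field_simps power2_eq_square intro!: integral_minus)
next
  case (Suc m)
  define d :: rat where "d = of_nat p - of_nat (Suc m)"
  have m: "0 < Suc m" "Suc m < p" "m < p" "0 < m" using Suc p_eq by auto
  have d: "d \<noteq> 0" "1 / d \<in> R" "of_nat p = d + of_nat (Suc m)"
    unfolding d_def using m integral_inverse_diff[OF m(1,2)] by auto
  have "fact_ratio (p - 1) (Suc m) = fact_ratio (p - 1) m * ((of_nat p + of_nat m) * (1 / d))"
    using m p_gt_2 by (subst fact_ratio_Suc_right) (auto simp: d_def of_nat_diff algebra_simps)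
  hence "(- 1) ^ Suc m * fact_ratio (p - 1) (Suc m)
      = (- 1) ^ m * fact_ratio (p - 1) m * (- (of_nat p + of_nat m) * (1 / d))"
    by (simp del: minus_add_distrib)
  also have "eqmod 2 \<dots> (of_nat p / of_nat m * (- (of_nat p + of_nat m) * (1 / d)))"
    using Suc d(1,2) by (intro eqmod_mult_right integral_mult integral_minus integral_add) auto
  also have "eqmod 2 \<dots> (of_nat p / of_nat (Suc m))"
  proof (rule eqmodI)
    show "- (2 * of_nat m + 1) * (1 / d) * (1 / of_nat m) * (1 / of_nat (Suc m)) \<in> R" (is "?z \<in> R")
      using m d(2) by (intro integral_mult integral_minus integral_add integral_inverse_less) auto
    show "of_nat p / of_nat m * (- (of_nat p + of_nat m) * (1 / d)) - of_nat p / of_nat (Suc m)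
        = of_nat p ^ 2 * ?z"
      unfolding d(3) using d(1) m
      by (simp add: divide_simps del: of_nat_Suc) (simp add: power2_eq_square algebra_simps)
  qed
  finally show ?case .
qed

text \<open>With b = 2m + 1, the factor from m to m + 1 is (b + p)/(b - p), congruent to 1 + 2p/b;
  the products of two terms 2p/b drop out modulo p^2.\<close>

lemma fact_ratio_half:
  "m \<le> h \<Longrightarrow> eqmod 2 ((- 1) ^ m * fact_ratio h m) (1 + 2 * of_nat p * odd_harm m)"
proof (induction m)
  case (Suc m)
  define b :: rat where "b = of_nat (2 * m + 1)"
  have m: "0 < 2 * m + 1" "2 * m + 1 < p" using Suc p_eq by auto
  have b: "b \<noteq> 0" "of_nat p - b \<noteq> 0" "1 / b \<in> R" "1 / (of_nat p - b) \<in> R"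
    unfolding b_def using m integral_inverse_diff[OF m] integral_inverse_less[OF m] by auto
  have O: "odd_harm (Suc m) = odd_harm m + 1 / b"
    by (simp add: b_def)
  have Oi: "odd_harm m \<in> R" using Suc by (intro odd_harm_integral) auto
  have hm: "(of_nat h - of_nat m :: rat) = (of_nat p - b) / 2" "(of_nat h + of_nat m + 1 :: rat) = (of_nat p + b) / 2"
    unfolding of_nat_p_eq b_def by simp_all
  have "fact_ratio h (Suc m) = fact_ratio h m * ((of_nat p + b) * (1 / (of_nat p - b)))"
    using Suc.prems by (subst fact_ratio_Suc_right) (simp_all add: hm)
  hence "(- 1) ^ Suc m * fact_ratio h (Suc m)
      = (- 1) ^ m * fact_ratio h m * (- (of_nat p + b) * (1 / (of_nat p - b)))"
    by (simp del: minus_add_distrib)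
  also have "eqmod 2 \<dots> ((1 + 2 * of_nat p * odd_harm m) * (1 + 2 * of_nat p * (1 / b)))"
  proof (rule eqmod_mult[OF _ _ _ eqmodI])
    show "(- 1) ^ m * fact_ratio h m \<in> R"
      using Suc.prems Oi by (intro eqmod_integral[OF Suc.IH] integral_add integral_mult) auto
    show "1 + 2 * of_nat p * (1 / b) \<in> R"
      using b by (intro integral_add integral_mult) auto
    show "- 2 * (1 / b) * (1 / (of_nat p - b)) \<in> R"
      using b by (intro integral_mult integral_minus) auto
    show "- (of_nat p + b) * (1 / (of_nat p - b)) - (1 + 2 * of_nat p * (1 / b))
        = of_nat p ^ 2 * (- 2 * (1 / b) * (1 / (of_nat p - b)))"
      using b by (simp add: divide_simps) (simp add: power2_eq_square algebra_simps)
  qed (use Suc in auto)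
  also have "eqmod 2 \<dots> (1 + 2 * of_nat p * odd_harm (Suc m))"
  proof (rule eqmodI)
    show "4 * odd_harm m * (1 / b) \<in> R"
      using b Oi by (intro integral_mult) auto
  qed (simp add: O algebra_simps power2_eq_square del: odd_harm_Suc)
  finally show ?case .
qed simp

text \<open>The exact evaluation is taken at M = p - 1 and n = h. Of the 14 multiples of p times
  \<open>double_harm\<close>, one comes from \<open>sum_odd_harm\<close>; the other 13 arise from
  \<open>harm 2 (p - 1)\<close> through \<open>double_harm_mod_p2\<close>.\<close>

lemma sum_q_term_mod_p2:
  "eqmod 2 (\<Sum>k=Suc h..p - 1. q_term h k) (14 * of_nat p * double_harm)"
proof -
  let ?X = "\<Sum>m=1..h. odd_harm m / of_nat m ^ 2"
  have "(\<Sum>k=Suc h..p - 1. q_term h k)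
      = harm 2 (p - 1) - harm 2 h - 2 * (\<Sum>m=1..h. ((- 1) ^ m * fact_ratio (p - 1) m - (- 1) ^ m * fact_ratio h m) * (1 / of_nat m ^ 2))"
    using sum_q_term[of h "p - 1"] p_minus_1 by (simp add: right_diff_distrib)
  also have "eqmod 2 \<dots> (harm 2 (p - 1) - harm 2 h
      - 2 * (\<Sum>m=1..h. (of_nat p / of_nat m - (1 + 2 * of_nat p * odd_harm m)) * (1 / of_nat m ^ 2)))"
    using p_eq
    by (intro eqmod_diff eqmod_mult_left eqmod_sum eqmod_mult_right eqmod_refl fact_ratio_half
        fact_ratio_p_minus_1 integral_divide_less) auto
  also have "(\<Sum>m=1..h. (of_nat p / of_nat m - (1 + 2 * of_nat p * odd_harm m)) * (1 / of_nat m ^ 2))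
      = (\<Sum>m=1..h. of_nat p * (1 / of_nat m ^ 3) - 1 / of_nat m ^ 2 - 2 * of_nat p * (odd_harm m / of_nat m ^ 2))"
    by (intro sum.cong refl)
      (simp add: diff_divide_distrib add_divide_distrib algebra_simps power2_eq_square power3_eq_cube)
  also have "\<dots> = of_nat p * harm 3 h - harm 2 h - 2 * of_nat p * ?X"
    unfolding harm_def by (simp only: sum_subtractf sum_distrib_left)
  finally obtain z0 where z0: "z0 \<in> R" "(\<Sum>k=Suc h..p - 1. q_term h k)
      = harm 2 (p - 1) + harm 2 h - 2 * of_nat p * harm 3 h + of_nat p * (4 * ?X) + of_nat p ^ 2 * z0"
    unfolding eqmod_def by (auto simp: algebra_simps)
  obtain z1 z2 where z12: "z1 \<in> R" "z2 \<in> R"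
    "harm 2 (p - 1) = 2 * harm 2 h + 2 * of_nat p * harm 3 h + of_nat p ^ 2 * z1"
    "harm 2 (p - 1) = harm 2 h / 2 + of_nat p * harm 3 h / 4 + of_nat p ^ 2 * z2"
    using harm_2_half harm_2_parity unfolding eqmod_def by (auto simp: algebra_simps)
  obtain z3 where z3: "z3 \<in> R" "4 * ?X = double_harm - 3 * harm 3 h + of_nat p * z3"
    using sum_odd_harm unfolding eqmod_def by (auto simp: algebra_simps)
  obtain z4 where z4: "z4 \<in> R" "of_nat p * double_harm = 3 / 2 * harm 2 (p - 1) + of_nat p ^ 2 * z4"
    using double_harm_mod_p2 unfolding eqmod_def by (auto simp: algebra_simps)
  have X: "of_nat p * (4 * ?X) = of_nat p * double_harm - 3 * (of_nat p * harm 3 h) + of_nat p ^ 2 * z3"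
    unfolding z3 by (simp add: algebra_simps power2_eq_square)
  \<comment> \<open>The coefficients \<open>11 / 2\<close> and \<open>- 24\<close> are those with which the two relations for
    \<open>harm 2 (p - 1)\<close> eliminate \<open>harm 2 h\<close> and \<open>harm 3 h\<close> together.\<close>
  show ?thesis
  proof (rule eqmodI)
    show "z0 + z3 - 13 * z4 + 11 * z1 / 2 - 24 * z2 \<in> R"
      using z0 z12 z3 z4 by (intro integral_add integral_diff integral_mult integral_half) auto
    show "(\<Sum>k=Suc h..p - 1. q_term h k) - 14 * of_nat p * double_harm
        = of_nat p ^ 2 * (z0 + z3 - 13 * z4 + 11 * z1 / 2 - 24 * z2)"
      using z0(2) z12(3,4) z4(2) X unfolding distrib_left right_diff_distrib mult.assoc by linarith
  qed
qed

section \<open>Reduction of the sum\<close>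

lemma sq_series_Suc':
  "sq_series $ Suc k = sq_series $ k * ((2 * of_nat k + 1) ^ 2 / (2 * of_nat (Suc k)) ^ 2)"
  using sq_series_Suc[of k] by (simp add: field_simps del: of_nat_Suc)

lemma binomial_p_minus_1_mod_p: "n < p \<Longrightarrow> eqmod 1 ((- 1) ^ n * of_nat ((p - 1) choose n)) 1"
proof -
  assume n: "n < p"
  have "eqmod 1 ((- 1) ^ n * of_nat ((p - 1) choose n)) (1 - of_nat p * harm 1 n)"
    by (rule eqmod_mono[OF binomial_p_minus_1[OF n]]) simp
  also have "eqmod 1 (1 - of_nat p * harm 1 n) 1"
    using harm_integral[OF n] by (intro eqmodI[of "- harm 1 n"]) (auto intro: integral_minus)
  finally show ?thesis .
qed

lemma fermat:
  assumes "\<not> p dvd a"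
  shows "eqmod 1 (of_nat a ^ (p - 1)) 1"
proof -
  have "[a ^ (p - 1) = 1] (mod p)" by (rule fermat_theorem[OF prime assms])
  hence "[int (a ^ (p - 1)) = 1] (mod int p)" by (metis cong_int_iff of_nat_1)
  hence "int p dvd int (a ^ (p - 1)) - 1" by (simp add: cong_iff_dvd_diff)
  then obtain c where "int (a ^ (p - 1)) - 1 = int p * c" by (elim dvdE)
  hence "of_int (int (a ^ (p - 1)) - 1) = (of_int (int p * c) :: rat)" by (rule arg_cong)
  thus ?thesis by (intro eqmodI[of "of_int c"]) simp_all
qed

text \<open>Here C(2h, h) = C(p - 1, h), and 16^h = 4^(p - 1) is 1 modulo p by Fermat's
  theorem.\<close>

lemma central_binomial_half: "eqmod 1 (of_nat ((2 * h) choose h) / 16 ^ h) ((- 1) ^ h)"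
proof -
  have "\<not> p dvd 4"
    using prime p_gt_2 prime_dvd_power[of p 2 2] nat_dvd_not_less[of 2 p] by auto
  hence "eqmod 1 (of_nat 4 ^ (p - 1)) 1" by (rule fermat)
  hence "eqmod 1 (16 ^ h) 1" unfolding p_minus_1 by (simp add: power_mult)
  have C: "(- 1) ^ h * of_nat ((2 * h) choose h) \<in> R" by (auto intro!: integral_mult integral_power integral_minus)
  have i16: "1 / 16 ^ h \<in> R"
    using integral_divide_4_power[of 1 "2 * h"] by (simp add: power_mult)
  have "eqmod 1 ((- 1) ^ h * ((- 1) ^ h * of_nat ((2 * h) choose h)) * (1 / 16 ^ h)) ((- 1) ^ h * 1 * (1 / 16 ^ h))"
    using binomial_p_minus_1_mod_p[of h] p_eq i16 unfolding p_minus_1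
    by (intro eqmod_mult_left eqmod_mult_right) (auto intro!: integral_power integral_minus)
  also have "(- 1) ^ h * 1 * (1 / 16 ^ h) = (- 1) ^ h * (1 / 16 ^ h) * (1 :: rat)" by simp
  also have "eqmod 1 \<dots> ((- 1) ^ h * (1 / 16 ^ h) * 16 ^ h)"
    using \<open>eqmod 1 (16 ^ h) 1\<close> i16
    by (intro eqmod_mult_left eqmod_sym[of _ "16 ^ h"] integral_mult integral_power integral_minus) auto
  also have "(- 1) ^ h * (1 / 16 ^ h) * 16 ^ h = ((- 1) ^ h :: rat)" by simp
  also have "(- 1) ^ h * ((- 1) ^ h * of_nat ((2 * h) choose h)) * (1 / 16 ^ h) = (of_nat ((2 * h) choose h) / 16 ^ h :: rat)"
    by (simp flip: mult.assoc power_mult_distrib)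
  finally show ?thesis .
qed

text \<open>The factor (2h + 1)^2 = p^2 enters at k = h + 1, so the start needs comparison only
  modulo p. Divisibility by p^2 is carried along in the induction to control the later
  factors.\<close>

lemma sq_series_mod_p3:
  assumes "Suc h \<le> k" "k < p"
  shows "eqmod 3 (sq_series $ k) (of_nat p / 4 * (of_nat k * q_term h k)) \<and> (\<exists>u\<in>R. sq_series $ k = of_nat p ^ 2 * u)"
  using assms
proof (induction k rule: dec_induct)
  case base
  let ?c = "of_nat ((2 * h) choose h) :: rat"
  let ?e = "1 / of_nat (Suc h) :: rat"
  have e: "?e \<in> R" using base p_eq by (intro integral_inverse_less) auto
  have i16: "1 / 16 ^ h \<in> R"
    using integral_divide_4_power[of 1 "2 * h"] by (simp add: power_mult)
  have "(2 * of_nat h + 1 :: rat) = of_nat p" unfolding of_nat_p_eq ..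
  hence s: "sq_series $ Suc h = of_nat p ^ 2 * (?c * (?c / 16 ^ h) * (?e ^ 2 / 4))"
    unfolding sq_series_Suc' by (simp add: sq_series_nth power2_eq_square ac_simps del: of_nat_Suc)
  have "?c * (fact h * fact h) = fact (2 * h)"
    using binomial_fact[of h "2 * h", where ?'a = rat] by simp
  moreover have "Suc h + h = Suc (2 * h)" by simp
  hence "fact (Suc h + h) = of_nat p * (fact (2 * h) :: rat)"
    using of_nat_p_eq by (simp only: fact_Suc) (simp add: add.commute)
  ultimately have q: "of_nat p / 4 * (of_nat (Suc h) * q_term h (Suc h)) = of_nat p ^ 2 * (?c * (- 1) ^ h * (?e ^ 2 / 4))"
    unfolding q_term_def by (simp add: power_mult_distrib power2_eq_square field_simps del: of_nat_Suc)
  have e4: "?e ^ 2 / 4 \<in> R"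
    using integral_divide_4_power[of "?e ^ 2" 1] e by auto
  have "eqmod 1 (?c * (?c / 16 ^ h) * (?e ^ 2 / 4)) (?c * (- 1) ^ h * (?e ^ 2 / 4))"
    using e4 by (intro eqmod_mult_right eqmod_mult_left central_binomial_half) auto
  hence "eqmod 3 (sq_series $ Suc h) (of_nat p / 4 * (of_nat (Suc h) * q_term h (Suc h)))"
    unfolding s q by (rule eqmod_scale) simp
  moreover have "?c * (?c / 16 ^ h) * (?e ^ 2 / 4) \<in> R"
    using e4 integral_mult[OF _ i16, of ?c] by (intro integral_mult) auto
  ultimately show ?case unfolding s by blast
next
  case (step k)
  then obtain u where IH: "eqmod 3 (sq_series $ k) (of_nat p / 4 * (of_nat k * q_term h k))"
    and u: "u \<in> R" "sq_series $ k = of_nat p ^ 2 * u"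
    by auto
  let ?e = "1 / of_nat (Suc k) :: rat"
  have e: "?e \<in> R" using step by (intro integral_inverse_less) auto
  have e4: "?e ^ 2 / 4 \<in> R"
    using integral_divide_4_power[of "?e ^ 2" 1] e by auto
  let ?r = "(2 * of_nat k + 1) ^ 2 * (?e ^ 2 / 4)"
  let ?r' = "((2 * of_nat k + 1) ^ 2 - of_nat p ^ 2) * (?e ^ 2 / 4)"
  have r: "?r \<in> R" and r': "?r' \<in> R"
    using e4 by (intro integral_mult integral_diff integral_power integral_add; simp)+
  have s: "sq_series $ Suc k = sq_series $ k * ?r"
    unfolding sq_series_Suc' by (simp add: power_mult_distrib power_divide del: of_nat_Suc)
  obtain d where d: "k = Suc (h + d)" using step.hyps(1) by (metis Suc_le_D Suc_le_mono le_Suc_ex)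
  \<comment> \<open>Subtracting p^2 makes the numerator split into 4(k - h)(k + h + 1), the ratio
    that \<open>q_term\<close> requires. As the term already carries p^2, the change is a multiple
    of p^4.\<close>
  have "((2 * of_nat k + 1) ^ 2 - of_nat p ^ 2 :: rat) = 4 * of_nat (Suc d) * of_nat (Suc (k + h))"
    unfolding of_nat_p_eq d by (simp add: power2_eq_square algebra_simps)
  hence q: "of_nat p / 4 * (of_nat (Suc k) * q_term h (Suc k)) = of_nat p / 4 * (of_nat k * q_term h k) * ?r'"
    unfolding q_term_def d
    by (simp add: field_simps power2_eq_square del: of_nat_Suc)
  have "eqmod 3 (sq_series $ k * ?r) (sq_series $ k * ?r')"
  proof (rule eqmodI)
    show "of_nat p * u * (?e ^ 2 / 4) \<in> R"
      using u e4 by (intro integral_mult) auto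
    show "sq_series $ k * ?r - sq_series $ k * ?r' = of_nat p ^ 3 * (of_nat p * u * (?e ^ 2 / 4))"
      unfolding u by (simp only: left_diff_distrib right_diff_distrib eval_nat_numeral power_Suc) (simp only: ac_simps, simp)
  qed
  also have "eqmod 3 \<dots> (of_nat p / 4 * (of_nat k * q_term h k) * ?r')"
    by (rule eqmod_mult_right[OF r' IH])
  finally have "eqmod 3 (sq_series $ k * ?r) (of_nat p / 4 * (of_nat k * q_term h k) * ?r')" .
  moreover have "u * ?r \<in> R" by (rule integral_mult[OF u(1) r])
  moreover have "sq_series $ k * ?r = of_nat p ^ 2 * (u * ?r)" by (simp only: u mult.assoc)
  ultimately show ?case unfolding s q by blast
qed

text \<open>Passing from j to j + 1 multiplies the binomial coefficient by 1 + p/(j + 1).\<close>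

lemma binomial_2k_p:
  "j < p \<Longrightarrow> eqmod 1 (of_nat ((p + j) choose p)) 1"
proof (induction j)
  case (Suc j)
  have b: "(p + j) choose p = (p + j) choose j" "(p + Suc j) choose p = Suc (p + j) choose Suc j"
    using binomial_symmetric[of p "p + j"] binomial_symmetric[of p "p + Suc j"] by simp_all
  have "of_nat (Suc j) * of_nat (Suc (p + j) choose Suc j) = (of_nat (Suc (p + j)) * of_nat ((p + j) choose j) :: rat)"
    using arg_cong[OF Suc_times_binomial[of j "p + j"], of of_nat] by (simp only: of_nat_mult)
  hence "of_nat ((p + Suc j) choose p) = of_nat ((p + j) choose p) + of_nat p * (of_nat ((p + j) choose p) * (1 / of_nat (Suc j)) :: rat)"
    unfolding b by (simp add: field_simps del: binomial_Suc_Suc)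
  moreover have "of_nat ((p + j) choose p) * (1 / of_nat (Suc j)) \<in> R"
    using Suc.prems by (intro integral_mult integral_inverse_less) auto
  ultimately have "eqmod 1 (of_nat ((p + Suc j) choose p)) (of_nat ((p + j) choose p))"
    by (intro eqmodI) auto
  also have "eqmod 1 \<dots> 1" using Suc by simp
  finally show ?case .
qed simp

text \<open>Both sides equal (2k)!/(k! a! b!) with a = p - 1 - k and b = 2k - p. The right-hand side
  exhibits the factor p, times two binomial coefficients known modulo p up to sign.\<close>

lemma binomial_product:
  assumes "Suc h \<le> k" "k < p"
  shows "k * ((2 * k) choose k) * ((k - 1) choose (p - 1 - k)) = p * ((2 * k) choose p) * ((p - 1) choose k)"
proof -
  define a where "a = p - 1 - k"
  define b where "b = 2 * k - p"
  have *: "k - 1 = a + b" "2 * k = p + b" "p = Suc (k + a)" "k = Suc (a + b)"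
    using assms p_eq by (auto simp: a_def b_def)
  have "(of_nat (k * ((2 * k) choose k) * ((k - 1) choose a)) :: rat)
      = of_nat k * (fact (2 * k) / (fact k * fact k)) * (fact (a + b) / (fact a * fact b))"
    using binomial_fact[of k "2 * k", where ?'a = rat] binomial_fact[of a "a + b", where ?'a = rat]
    unfolding *(1) of_nat_mult by simp
  also have "\<dots> = fact (2 * k) / (fact k * fact a * fact b)"
    using fact_Suc[of "a + b", where ?'a = rat] unfolding *(4)[symmetric] by simp
  also have "\<dots> = of_nat p * (fact (2 * k) / (fact p * fact b)) * (fact (p - 1) / (fact k * fact a))"
    using fact_reduce[of p, where ?'a = rat] p_gt_2 by simp
  also have "\<dots> = of_nat (p * ((2 * k) choose p) * ((p - 1) choose k))"
  proof -
    have "p \<le> 2 * k" "2 * k - p = b" "k \<le> p - 1" "p - 1 - k = a"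
      using assms p_eq by (auto simp: a_def b_def)
    thus ?thesis
      using binomial_fact[of p "2 * k", where ?'a = rat] binomial_fact[of k "p - 1", where ?'a = rat] by simp
  qed
  finally show ?thesis unfolding a_def by (simp only: of_nat_eq_iff)
qed

lemma sum_V_mod_p4:
  "eqmod 4 (\<Sum>n=1..p - 1. of_nat (V n) / 16 ^ n) (of_nat p ^ 2 * (1 / 4 * (\<Sum>k=Suc h..p - 1. q_term h k)))"
proof -
  let ?t = "\<lambda>k. of_nat ((2 * k) choose k) ^ 3 / 16 ^ k * ((- 1) ^ (p - 1 - k) * of_nat ((k - 1) choose (p - 1 - k))) :: rat"
  have "(\<Sum>n=1..p - 1. of_nat (V n) / 16 ^ n :: rat) = (\<Sum>k=1..p - 1. ?t k)"
    by (rule sum_V)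
  \<comment> \<open>For k up to h the lower index p - 1 - k exceeds k - 1, so the binomial
    coefficient vanishes.\<close>
  also have "\<dots> = (\<Sum>k=Suc h..p - 1. ?t k)"
    using p_eq by (intro sum.mono_neutral_right) (auto simp: binomial_eq_0)
  also have "eqmod 4 \<dots> (\<Sum>k=Suc h..p - 1. of_nat p ^ 2 * (1 / 4 * q_term h k))"
  proof (intro eqmod_sum)
    fix k assume k: "k \<in> {Suc h..p - 1}"
    hence k': "Suc h \<le> k" "k < p" "0 < k" using p_gt_2 by auto
    obtain u where sq: "eqmod 3 (sq_series $ k) (of_nat p / 4 * (of_nat k * q_term h k))"
      and u: "u \<in> R" "sq_series $ k = of_nat p ^ 2 * u"
      using sq_series_mod_p3[OF k'(1,2)] by auto
    let ?b = "of_nat ((2 * k) choose p) :: rat"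
    let ?c = "(- 1) ^ k * of_nat ((p - 1) choose k) :: rat"
    have b: "eqmod 1 ?b 1"
      using binomial_2k_p[of "2 * k - p"] k' p_eq by simp
    have c: "eqmod 1 ?c 1"
      using binomial_p_minus_1_mod_p[of k] k' by simp
    have par: "(- 1) ^ (p - 1 - k) = ((- 1) ^ k :: rat)"
      using k' odd by (intro minus_one_power_iff[THEN trans] sym[OF minus_one_power_iff[THEN trans]]) auto
    have "of_nat k * of_nat ((2 * k) choose k) * of_nat ((k - 1) choose (p - 1 - k))
        = (of_nat p * ?b * of_nat ((p - 1) choose k) :: rat)"
      using arg_cong[OF binomial_product[OF k'(1,2)], of of_nat] by (simp only: of_nat_mult)
    hence "of_nat ((2 * k) choose k) * of_nat ((k - 1) choose (p - 1 - k))
        = (of_nat p * ?b * of_nat ((p - 1) choose k) * (1 / of_nat k) :: rat)"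
      using k' by (simp add: field_simps)
    \<comment> \<open>Two of the three central binomial factors form \<open>sq_series\<close>,
      divisible by p^2; the third, combined with the other binomial coefficient, contributes one
      more p.\<close>
    hence "?t k = sq_series $ k * ((- 1) ^ k * (of_nat p * ?b * of_nat ((p - 1) choose k) * (1 / of_nat k)))"
      unfolding par sq_series_nth power3_eq_cube power2_eq_square by (simp add: field_simps)
    hence t: "?t k = of_nat p ^ 3 * (u * (1 / of_nat k) * (?b * ?c))"
      unfolding u by (simp add: power3_eq_cube power2_eq_square)
    have i: "1 / of_nat k \<in> R" using k' by (intro integral_inverse_less) auto
    have "eqmod 1 (u * (1 / of_nat k) * (?b * ?c)) (u * (1 / of_nat k) * (1 * 1))"
      by (intro eqmod_mult_left[OF integral_mult[OF u(1) i]] eqmod_mult b c) auto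
    hence "eqmod 4 (?t k) (of_nat p ^ 3 * (u * (1 / of_nat k) * (1 * 1)))"
      unfolding t by (rule eqmod_scale) simp
    also have "of_nat p ^ 3 * (u * (1 / of_nat k) * (1 * 1)) = of_nat p ^ 1 * (sq_series $ k * (1 / of_nat k))"
      unfolding u by (simp add: power3_eq_cube power2_eq_square)
    also have "eqmod 4 \<dots> (of_nat p ^ 1 * (of_nat p / 4 * (of_nat k * q_term h k) * (1 / of_nat k)))"
      by (rule eqmod_scale[OF eqmod_mult_right[OF i sq]]) simp
    also have "of_nat p ^ 1 * (of_nat p / 4 * (of_nat k * q_term h k) * (1 / of_nat k)) = of_nat p ^ 2 * (1 / 4 * q_term h k)"
      using k' by (simp add: power2_eq_square)
    finally show "eqmod 4 (?t k) (of_nat p ^ 2 * (1 / 4 * q_term h k))" by simp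
  qed
  finally show ?thesis by (simp add: sum_distrib_left)
qed

lemma sum_V_double_harm: "eqmod 4 (\<Sum>n=1..p - 1. of_nat (V n) / 16 ^ n) (7 / 2 * of_nat p ^ 3 * double_harm)"
proof -
  have "eqmod 4 (of_nat p ^ 2 * (1 / 4 * (\<Sum>k=Suc h..p - 1. q_term h k))) (of_nat p ^ 2 * (1 / 4 * (14 * of_nat p * double_harm)))"
    using integral_divide_4_power[of 1 1]
    by (intro eqmod_scale[of 2] eqmod_mult_left sum_q_term_mod_p2) auto
  also have "of_nat p ^ 2 * (1 / 4 * (14 * of_nat p * double_harm)) = 7 / 2 * of_nat p ^ 3 * double_harm"
    by (simp add: power2_eq_square power3_eq_cube)
  finally show ?thesis using eqmod_trans[OF sum_V_mod_p4] by simp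
qed

section \<open>The double sum and Bernoulli numbers\<close>

text \<open>Below index p - 1 the recursion divides only by numbers less than p.\<close>

lemma bernoulli_integral: "k < p - 1 \<Longrightarrow> bernoulli k \<in> R"
proof (induction k rule: less_induct)
  case (less k)
  have "(\<Sum>i<k. of_nat (Suc k choose i) * bernoulli i) * (1 / of_nat (Suc k)) \<in> R"
    using less by (intro integral_mult integral_sum integral_inverse_less) auto
  thus ?case using less.prems
    by (subst bernoulli.simps) (auto dest: integral_minus)
qed

text \<open>Faulhaber's formula at j = p: every term contains p, and all Bernoulli numbers involved
  are integral at p.\<close>

lemma power_sum_mod_p:
  assumes "1 \<le> e" "e < p - 1"
  shows "eqmod 1 (\<Sum>j=1..p - 1. of_nat j ^ e) 0"
proof (rule eqmodI)
  let ?z = "1 / of_nat (Suc e) * (\<Sum>k\<le>e. of_nat (Suc e choose k) * bernoulli k * of_nat p ^ (e - k))"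
  show "?z \<in> R"
    using assms
    by (intro integral_mult integral_inverse_less integral_sum integral_power bernoulli_integral) auto
  have "{..<p} = insert 0 {1..p - 1}" using p_gt_2 by auto
  hence "(\<Sum>i<p. of_nat i ^ e) = (\<Sum>j=1..p - 1. of_nat j ^ e :: rat)"
    using assms by simp
  moreover have "(\<Sum>k\<le>e. of_nat (Suc e choose k) * bernoulli k * of_nat p ^ (Suc e - k))
      = of_nat p * (\<Sum>k\<le>e. of_nat (Suc e choose k) * bernoulli k * of_nat p ^ (e - k))"
    unfolding sum_distrib_left by (intro sum.cong refl) (simp add: Suc_diff_le)
  ultimately show "(\<Sum>j=1..p - 1. of_nat j ^ e) - 0 = of_nat p ^ 1 * ?z"
    using faulhaber[of e p] by (simp add: field_simps del: of_nat_Suc binomial_Suc_Suc)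
qed

lemma inverse_mod_p:
  assumes "0 < i" "i < p"
  shows "eqmod 1 (1 / of_nat i) (of_nat i ^ (p - 2))"
proof -
  have i: "1 / of_nat i \<in> R" using assms by (rule integral_inverse_less)
  have "\<not> p dvd i" using assms by (auto dest: dvd_imp_le)
  hence "eqmod 1 (1 / of_nat i * 1) (1 / of_nat i * of_nat i ^ (p - 1))"
    by (intro eqmod_mult_left i eqmod_sym[OF fermat])
  moreover have "p - 1 = Suc (p - 2)" using p_gt_2 by simp
  ultimately show ?thesis using assms by simp
qed

lemma harm_1_bernoulli:
  assumes "1 \<le> j" "j < p"
  shows "eqmod 1 (harm 1 (j - 1))
    (1 / of_nat (p - 1) * (\<Sum>k\<le>p - 2. of_nat ((p - 1) choose k) * bernoulli k * of_nat j ^ (p - 1 - k)))"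
proof -
  have p1: "Suc (p - 2) = p - 1" and p0: "(of_nat (p - 1) :: rat) \<noteq> 0" using p_gt_2 by auto
  have "harm 1 (j - 1) = (\<Sum>i=1..j - 1. 1 / of_nat i)"
    by (simp add: harm_def)
  also have "eqmod 1 \<dots> (\<Sum>i=1..j - 1. of_nat i ^ (p - 2))"
    using assms by (intro eqmod_sum inverse_mod_p) auto
  \<comment> \<open>Index 0 may be added because the exponent p - 2 is positive.\<close>
  also have "(\<Sum>i=1..j - 1. of_nat i ^ (p - 2) :: rat) = (\<Sum>i<j. of_nat i ^ (p - 2))"
    using assms p_gt_2 by (intro sum.mono_neutral_left) (auto simp: power_0_left)
  also have "\<dots> = 1 / of_nat (p - 1) * (\<Sum>k\<le>p - 2. of_nat ((p - 1) choose k) * bernoulli k * of_nat j ^ (p - 1 - k))"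
    using faulhaber[of "p - 2" j] p0 unfolding p1 by (simp add: field_simps)
  finally show ?thesis .
qed

text \<open>Expanding the inner harmonic number by Faulhaber's formula leaves sums of j^(p - 3 - k).
  Modulo p only the exponent 0 survives; it selects k = p - 3 and its value p - 1 cancels the
  prefactor.\<close>

lemma double_harm_bernoulli: "eqmod 1 double_harm (bernoulli (p - 3))"
proof -
  define c where "c k = of_nat ((p - 1) choose k) * bernoulli k" for k
  have c: "c k \<in> R" if "k \<le> p - 2" for k
    unfolding c_def using that p_gt_2 by (intro integral_mult bernoulli_integral) auto
  have i: "1 / of_nat (p - 1) \<in> R" using p_gt_2 by (intro integral_inverse_less) auto
  \<comment> \<open>The division by j^2 stays separate because the exponent p - 3 - k is -1 for k =
    p - 2, where the sum is \<open>harm 1 (p - 1)\<close>.\<close>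
  have S: "eqmod 1 (\<Sum>j=1..p - 1. of_nat j ^ (p - 1 - k) * (1 / of_nat j ^ 2)) (if k = p - 3 then of_nat (p - 1) else 0)"
    if k: "k \<le> p - 2" for k
  proof -
    consider "k = p - 2" | "k = p - 3" | "k < p - 3" using k by linarith
    thus ?thesis
    proof cases
      case 1
      hence "p - 1 - k = 1" "k \<noteq> p - 3" using p_gt_2 by auto
      thus ?thesis using harm_odd_mod_p[of 1] by (simp add: harm_def power2_eq_square)
    next
      case 2
      hence "p - 1 - k = 2" using p_gt_2 by auto
      thus ?thesis using 2 by simp
    next
      case 3
      define e where "e = p - 3 - k"
      have e: "p - 1 - k = e + 2" "1 \<le> e" "e < p - 1" using 3 by (auto simp: e_def)
      have "(\<Sum>j=1..p - 1. of_nat j ^ (e + 2) * (1 / of_nat j ^ 2)) = (\<Sum>j=1..p - 1. of_nat j ^ e :: rat)"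
        by (intro sum.cong refl) (simp only: power_add, simp)
      thus ?thesis using power_sum_mod_p[OF e(2,3)] 3 unfolding e(1) by simp
    qed
  qed
  have "eqmod 1 (\<Sum>j=1..p - 1. harm 1 (j - 1) * (1 / of_nat j ^ 2))
      (\<Sum>j=1..p - 1. 1 / of_nat (p - 1) * (\<Sum>k\<le>p - 2. c k * of_nat j ^ (p - 1 - k)) * (1 / of_nat j ^ 2))"
    unfolding c_def
    by (intro eqmod_sum eqmod_mult_right harm_1_bernoulli integral_divide_less) auto
  hence "eqmod 1 double_harm (\<Sum>j=1..p - 1. 1 / of_nat (p - 1) * (\<Sum>k\<le>p - 2. c k * of_nat j ^ (p - 1 - k)) * (1 / of_nat j ^ 2))"
    by (simp add: double_harm_def)
  also have "\<dots> = 1 / of_nat (p - 1) * (\<Sum>k\<le>p - 2. c k * (\<Sum>j=1..p - 1. of_nat j ^ (p - 1 - k) * (1 / of_nat j ^ 2)))"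
    unfolding sum_distrib_left sum_distrib_right by (subst sum.swap) (simp only: ac_simps)
  also have "eqmod 1 \<dots> (1 / of_nat (p - 1) * (\<Sum>k\<le>p - 2. c k * (if k = p - 3 then of_nat (p - 1) else 0)))"
    by (intro eqmod_mult_left i eqmod_sum c S) auto
  also have "\<dots> = c (p - 3)"
    using p_gt_2 by (simp add: sum.delta' if_distrib[of "\<lambda>x. _ * x"] cong: if_cong)
  also have "eqmod 1 \<dots> (1 * bernoulli (p - 3))"
  proof -
    have "even (p - 3)" using odd p_gt_2 by simp
    hence "eqmod 1 (of_nat ((p - 1) choose (p - 3))) 1"
      using binomial_p_minus_1_mod_p[of "p - 3"] p_gt_2 by simp
    thus ?thesis unfolding c_def
      using p_gt_2 by (intro eqmod_mult_right bernoulli_integral) auto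
  qed
  finally show ?thesis by simp
qed

lemma sum_V_bernoulli:
  "eqmod 4 (\<Sum>n=1..p - 1. of_nat (V n) / 16 ^ n) (7 / 2 * of_nat p ^ 3 * bernoulli (p - 3))"
proof -
  have "eqmod 4 (of_nat p ^ 3 * (7 / 2 * double_harm)) (of_nat p ^ 3 * (7 / 2 * bernoulli (p - 3)))"
    by (rule eqmod_scale[OF eqmod_mult_left[OF _ double_harm_bernoulli]]) (auto intro: integral_half)
  thus ?thesis using eqmod_trans[OF sum_V_double_harm, of "7 / 2 * of_nat p ^ 3 * bernoulli (p - 3)"]
    by (simp add: ac_simps)
qed

end

theorem theorem3p6:
  fixes p :: nat
  assumes "prime p" and "odd p"
  shows "p_cong p (p ^ 4)
           (\<Sum>n=1..p - 1. of_nat (V n) / 16 ^ n)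
           (7 / 2 * of_nat p ^ 3 * bernoulli (p - 3))"
proof -
  interpret odd_prime p by unfold_locales (fact assms)+
  \<comment> \<open>\<open>p_cong\<close> demands that both sides be integral at p; the sum inherits
    this from the right-hand side through the congruence.\<close>
  have "7 / 2 * of_nat p ^ 3 * bernoulli (p - 3) \<in> p_integral p"
    using p_gt_2 by (intro integral_mult integral_power bernoulli_integral integral_half) auto
  thus ?thesis
    using sum_V_bernoulli eqmod_integral[OF sum_V_bernoulli]
    unfolding p_cong_def eqmod_def by simp
qed

end
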